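(* Let $\Upsilon=(\Gamma,\sigma,\varphi)$ be a gain signed graph with gains in $\mathbb{K}^+$, and define for $S\subseteq E_\infty=E\cup\{e_\infty\}$ $$\mathrm{rk}_\Upsilon(S)=n-b_\Sigma(S)+\delta_\Upsilon(S),$$ where $\delta_\Upsilon(S)=0$ if $S$ is hyperbalanced and $\delta_\Upsilon(S)=1$ if $S$ is hyperfrustrated (every set containing $e_\infty$ counts as hyperfrustrated, and $e_\infty$ does not affect $b_\Sigma$). Then $\mathrm{rk}_\Upsilon$ is the rank function of a matroid on $E_\infty$, and for every $S\subseteq E_\infty$, $$\mathrm{rk}_\Upsilon(S)=\dim \operatorname{span}\{\mathbf{z}(e): e\in S\}.$$
   Context: Let $\mathbb{K}$ be a field of characteristic different from $2$. A graph $\Gamma=(V,E)$ has vertex set $V=\{v_1,\dots,v_n\}$ and finite edge set $E$; each edge is a link (two ends at two distinct vertices), a loop (two ends at the same vertex), a half edge (one end, at one vertex) or a loose edge (no ends); parallel edges are allowed. A gain signed graph is $\Upsilon=(\Gamma,\sigma,\varphi)$ where $\sigma:E\to\{+1,-1\}$ is a sign function with every half edge negative and every loose edge positive, and $\varphi$ is a gain function as follows. An orientation $\tau$ assigns to each end of an edge $e$ at a vertex $v$ a sign $\tau(v,e)\in\{\pm1\}$, with $\tau(v,e)\tau(w,e)=-\sigma(e)$ whenever $e$ is a link or loop with ends at $v,w$. With an orientation fixed, each edge $e$ has a gain $\varphi(e)\in\mathbb{K}$; reorienting $e$ (negating its $\tau$-values) negates $\varphi(e)$. An edge is neutral if its gain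 is $0$. Walk gains: for a walk $W=u_0e_1u_1\cdots e_lu_l$ put $\sigma(W)=\prod_i\sigma(e_i)$, $W_{0,j}=u_0e_1\cdots e_ju_j$, and $\varphi(W)=-\sum_{i=1}^l\varphi(e_i)\sigma(W_{0,i-1})\tau(u_{i-1},e_i)$. An ultrawalk is a walk that may also begin with a half edge $e_0$ at $u_0$ and/or end with a half edge $e_{l+1}$ at $u_l$; its gain is $\varphi(W_{0,l})$ plus $\tau(u_0,e_0)\varphi(e_0)$ if there is an initial half edge, plus $-\varphi(e_{l+1})\sigma(W_{0,l})\tau(u_l,e_{l+1})$ if there is a terminal half edge. A circle is a connected 2-regular subgraph (or its edge set); its sign is the product of its edge signs. A negative figure is a negative circle or a half edge. A sign circuit is a positive circle, a loose edge, or a handcuff: two negative figures with exactly one common vertex, or two vertex-disjoint negative figures together with a path joining them meeting them only at its endpoints. The gain $\varphi(C)$ of a sign circuit $C$ is the edge gain if $C$ is a loose edge, and otherwise $\varphi(W)$ for a circuit walk $W$: once around $C$ if $C$ is a positive circle; for a handcuff of circles $C_1,C_2$ with connecting path $P$ (length $\ge0$) from $u_1\in C_1$ to $u_2\in C_2$, the closed walk once around $C_1$ from $u_1$, along $P$, once around $C_2$, back along $P$; if $C_1$ is a half edge $h$ and $C_2$ a circle, the ultrawalk starting with $h$, along $P$, once around $C_2$, back along $P$, ending with $h$; if both figures are half edges, the ultrawalk from one along $P$ to the other. This is well defined up to sign, and $C$ is neutral if $\varphi(C)=0$. An edge set $S$ is hyperbalanced if every sign circuit contained in $S$ is neutral,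 hyperfrustrated otherwise; $S$ is sign balanced if it contains no negative circle and no half edge. Components of $S$ are the connected components of the spanning subgraph $(V,S)$ (loose edges belong to no component; isolated vertices are components); $b_\Sigma(S)$ is the number of sign-balanced components of $S$. Vector model in $\mathbb{K}^{1+n}$ with standard basis $\mathbf{e}_0,\dots,\mathbf{e}_n$: for a link or loop $e$ with ends at $v_i,v_j$, $\mathbf{z}(e)=\varphi(e)\mathbf{e}_0+\tau(v_i,e)\mathbf{e}_i+\tau(v_j,e)\mathbf{e}_j$ (for a loop the two $\tau$-terms are added in coordinate $i$); for a half edge at $v_i$, $\mathbf{z}(e)=\varphi(e)\mathbf{e}_0+\tau(v_i,e)\mathbf{e}_i$; for a loose edge, $\mathbf{z}(e)=\varphi(e)\mathbf{e}_0$; and $\mathbf{z}(e_\infty)=\mathbf{e}_0$ for the extra element $e_\infty$ (not an edge). *)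

theory Defs
  imports Complex_Main "HOL-Library.Function_Algebras"
begin

section \<open>Gain signed graphs\<close>

text \<open>
  An edge is given by the list \<open>ends\<close> of the vertices at which its ends lie: a loose edge has
  \<open>[]\<close>, a half edge \<open>[v]\<close>, a loop \<open>[v, v]\<close>, a link \<open>[v, w]\<close> with \<open>v \<noteq> w\<close>.  The order only names
  the two ends (end 0 and end 1).  The orientation \<open>orient e i\<close> is the sign of the end number \<open>i\<close>,
  so the two ends of a loop at \<open>v\<close>, both written \<open>\<tau>(v,e)\<close> on paper, are kept apart; for a positive
  loop they carry opposite signs.  \<open>gain\<close> is the gain function relative to this orientation.
\<close>

record ('v, 'e, 'k) gain_sgraph =
  verts  :: "'v set"
  edges  :: "'e set"
  ends   :: "'e \<Rightarrow> 'v list"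
  esign  :: "'e \<Rightarrow> int"
  orient :: "'e \<Rightarrow> nat \<Rightarrow> int"
  gain   :: "'e \<Rightarrow> 'k"

definition loose_edge :: "('v, 'e, 'k) gain_sgraph \<Rightarrow> 'e \<Rightarrow> bool" where
  "loose_edge G e \<longleftrightarrow> e \<in> edges G \<and> length (ends G e) = 0"

definition half_edge :: "('v, 'e, 'k) gain_sgraph \<Rightarrow> 'e \<Rightarrow> bool" where
  "half_edge G e \<longleftrightarrow> e \<in> edges G \<and> length (ends G e) = 1"

definition link_or_loop :: "('v, 'e, 'k) gain_sgraph \<Rightarrow> 'e \<Rightarrow> bool" where
  "link_or_loop G e \<longleftrightarrow> e \<in> edges G \<and> length (ends G e) = 2"

locale gain_signed_graph =
  fixes G :: "('v, 'e, 'k :: field) gain_sgraph"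
  assumes finite_verts: "finite (verts G)"
    and finite_edges: "finite (edges G)"
    and length_ends: "e \<in> edges G \<Longrightarrow> length (ends G e) \<le> 2"
    and ends_verts: "e \<in> edges G \<Longrightarrow> set (ends G e) \<subseteq> verts G"
    and esign_values: "e \<in> edges G \<Longrightarrow> esign G e \<in> {1, -1}"
    and half_edge_negative: "half_edge G e \<Longrightarrow> esign G e = -1"
    and loose_edge_positive: "loose_edge G e \<Longrightarrow> esign G e = 1"
    and orient_values: "e \<in> edges G \<Longrightarrow> i < length (ends G e) \<Longrightarrow> orient G e i \<in> {1, -1}"
    and orient_esign: "link_or_loop G e \<Longrightarrow> orient G e 0 * orient G e 1 = - esign G e"

section \<open>Walks and their gains\<close>

text \<open>
  A step \<open>(e, i)\<close> of a walk traverses the link or loop \<open>e\<close>, leaving through its end \<open>i\<close> and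
  arriving through the other end \<open>1 - i\<close>.  The factor \<open>\<tau>(u\<^sub>i\<^sub>-\<^sub>1, e\<^sub>i)\<close> in the gain of a walk is the
  sign of the end through which the step leaves.
\<close>

type_synonym 'e step = "'e \<times> nat"

definition is_step :: "('v, 'e, 'k) gain_sgraph \<Rightarrow> 'e step \<Rightarrow> bool" where
  "is_step G d \<longleftrightarrow> link_or_loop G (fst d) \<and> snd d < 2"

definition tail :: "('v, 'e, 'k) gain_sgraph \<Rightarrow> 'e step \<Rightarrow> 'v" where
  "tail G d = ends G (fst d) ! snd d"

definition head :: "('v, 'e, 'k) gain_sgraph \<Rightarrow> 'e step \<Rightarrow> 'v" where
  "head G d = ends G (fst d) ! (1 - snd d)"

fun walk :: "('v, 'e, 'k) gain_sgraph \<Rightarrow> 'v \<Rightarrow> 'e step list \<Rightarrow> 'v \<Rightarrow> bool" where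
  "walk G u [] v \<longleftrightarrow> u \<in> verts G \<and> u = v"
| "walk G u (d # W) v \<longleftrightarrow> is_step G d \<and> tail G d = u \<and> walk G (head G d) W v"

definition walk_verts :: "('v, 'e, 'k) gain_sgraph \<Rightarrow> 'v \<Rightarrow> 'e step list \<Rightarrow> 'v list" where
  "walk_verts G u W = u # map (head G) W"

definition walk_edges :: "'e step list \<Rightarrow> 'e list" where
  "walk_edges W = map fst W"

definition rev_walk :: "'e step list \<Rightarrow> 'e step list" where
  "rev_walk W = map (\<lambda>(e, i). (e, 1 - i)) (rev W)"

definition walk_sign :: "('v, 'e, 'k) gain_sgraph \<Rightarrow> 'e step list \<Rightarrow> int" where
  "walk_sign G W = (\<Prod>e\<leftarrow>walk_edges W. esign G e)"

definition walk_gain :: "('v, 'e, 'k :: field) gain_sgraph \<Rightarrow> 'e step list \<Rightarrow> 'k" where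
  "walk_gain G W =
     - (\<Sum>j<length W. gain G (fst (W ! j)) * of_int (walk_sign G (take j W))
                       * of_int (orient G (fst (W ! j)) (snd (W ! j))))"

text \<open>An ultrawalk: an optional initial half edge, a walk, an optional terminal half edge.\<close>

type_synonym 'e ultrawalk = "'e option \<times> 'e step list \<times> 'e option"

fun ultrawalk_gain :: "('v, 'e, 'k :: field) gain_sgraph \<Rightarrow> 'e ultrawalk \<Rightarrow> 'k" where
  "ultrawalk_gain G (a, W, b) =
     walk_gain G W
     + (case a of None \<Rightarrow> 0 | Some h \<Rightarrow> of_int (orient G h 0) * gain G h)
     + (case b of None \<Rightarrow> 0
        | Some h \<Rightarrow> - gain G h * of_int (walk_sign G W) * of_int (orient G h 0))"

section \<open>Connectivity, circles and sign circuits\<close>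

definition vset :: "('v, 'e, 'k) gain_sgraph \<Rightarrow> 'e set \<Rightarrow> 'v set" where
  "vset G C = (\<Union>e\<in>C. set (ends G e))"

definition degree :: "('v, 'e, 'k) gain_sgraph \<Rightarrow> 'e set \<Rightarrow> 'v \<Rightarrow> nat" where
  "degree G C v = (\<Sum>e\<in>C. count_list (ends G e) v)"

definition adjacency :: "('v, 'e, 'k) gain_sgraph \<Rightarrow> 'e set \<Rightarrow> ('v \<times> 'v) set" where
  "adjacency G S = {(u, v). \<exists>e\<in>S. link_or_loop G e \<and> set (ends G e) = {u, v}}"

text \<open>Two vertices lie in the same component of the spanning subgraph \<open>(V, S)\<close>.\<close>

definition connected_in :: "('v, 'e, 'k) gain_sgraph \<Rightarrow> 'e set \<Rightarrow> ('v \<times> 'v) set" where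
  "connected_in G S = {(u, v). u \<in> verts G \<and> v \<in> verts G \<and> (u, v) \<in> (adjacency G S)\<^sup>*}"

definition circle :: "('v, 'e, 'k) gain_sgraph \<Rightarrow> 'e set \<Rightarrow> bool" where
  "circle G C \<longleftrightarrow> C \<noteq> {} \<and> (\<forall>e\<in>C. link_or_loop G e)
     \<and> (\<forall>v\<in>vset G C. degree G C v = 2)
     \<and> (\<forall>u\<in>vset G C. \<forall>v\<in>vset G C. (u, v) \<in> connected_in G C)"

definition set_sign :: "('v, 'e, 'k) gain_sgraph \<Rightarrow> 'e set \<Rightarrow> int" where
  "set_sign G C = (\<Prod>e\<in>C. esign G e)"

definition positive_circle :: "('v, 'e, 'k) gain_sgraph \<Rightarrow> 'e set \<Rightarrow> bool" where
  "positive_circle G C \<longleftrightarrow> circle G C \<and> set_sign G C = 1"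

definition negative_circle :: "('v, 'e, 'k) gain_sgraph \<Rightarrow> 'e set \<Rightarrow> bool" where
  "negative_circle G C \<longleftrightarrow> circle G C \<and> set_sign G C = -1"

definition negative_figure :: "('v, 'e, 'k) gain_sgraph \<Rightarrow> 'e set \<Rightarrow> bool" where
  "negative_figure G F \<longleftrightarrow> negative_circle G F \<or> (\<exists>h. half_edge G h \<and> F = {h})"

definition path :: "('v, 'e, 'k) gain_sgraph \<Rightarrow> 'v \<Rightarrow> 'e step list \<Rightarrow> 'v \<Rightarrow> bool" where
  "path G u P v \<longleftrightarrow> walk G u P v \<and> distinct (walk_verts G u P)"

text \<open>
  Two negative figures \<open>F\<^sub>1, F\<^sub>2\<close> joined by the path \<open>P\<close> from \<open>u\<^sub>1\<close> to \<open>u\<^sub>2\<close>; the path is empty when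
  the figures share exactly one vertex.  The condition \<open>F\<^sub>1 \<noteq> F\<^sub>2\<close> is needed because a single half
  edge or negative loop shares exactly one vertex with itself.
\<close>

definition joined_figures ::
  "('v, 'e, 'k) gain_sgraph \<Rightarrow> 'e set \<Rightarrow> 'v \<Rightarrow> 'e step list \<Rightarrow> 'v \<Rightarrow> 'e set \<Rightarrow> bool" where
  "joined_figures G F\<^sub>1 u\<^sub>1 P u\<^sub>2 F\<^sub>2 \<longleftrightarrow>
     negative_figure G F\<^sub>1 \<and> negative_figure G F\<^sub>2 \<and> F\<^sub>1 \<noteq> F\<^sub>2 \<and> path G u\<^sub>1 P u\<^sub>2 \<and>
     (P = [] \<and> vset G F\<^sub>1 \<inter> vset G F\<^sub>2 = {u\<^sub>1} \<or>
      vset G F\<^sub>1 \<inter> vset G F\<^sub>2 = {} \<and>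
      set (walk_verts G u\<^sub>1 P) \<inter> vset G F\<^sub>1 = {u\<^sub>1} \<and>
      set (walk_verts G u\<^sub>1 P) \<inter> vset G F\<^sub>2 = {u\<^sub>2})"

definition handcuff :: "('v, 'e, 'k) gain_sgraph \<Rightarrow> 'e set \<Rightarrow> bool" where
  "handcuff G C \<longleftrightarrow> (\<exists>F\<^sub>1 u\<^sub>1 P u\<^sub>2 F\<^sub>2. joined_figures G F\<^sub>1 u\<^sub>1 P u\<^sub>2 F\<^sub>2
     \<and> C = F\<^sub>1 \<union> set (walk_edges P) \<union> F\<^sub>2)"

definition sign_circuit :: "('v, 'e, 'k) gain_sgraph \<Rightarrow> 'e set \<Rightarrow> bool" where
  "sign_circuit G C \<longleftrightarrow>
     positive_circle G C \<or> (\<exists>e. loose_edge G e \<and> C = {e}) \<or> handcuff G C"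

text \<open>
  In a connected 2-regular graph, a closed walk using every edge exactly once is precisely a walk
  once around it.
\<close>

definition once_around :: "('v, 'e, 'k) gain_sgraph \<Rightarrow> 'e set \<Rightarrow> 'v \<Rightarrow> 'e step list \<Rightarrow> bool" where
  "once_around G C u W \<longleftrightarrow>
     circle G C \<and> walk G u W u \<and> distinct (walk_edges W) \<and> set (walk_edges W) = C"

inductive circuit_walk :: "('v, 'e, 'k) gain_sgraph \<Rightarrow> 'e set \<Rightarrow> 'e ultrawalk \<Rightarrow> bool"
  for G where
  positive_circle:
    "positive_circle G C \<Longrightarrow> once_around G C u W \<Longrightarrow> circuit_walk G C (None, W, None)"
| circle_circle:
    "joined_figures G C\<^sub>1 u\<^sub>1 P u\<^sub>2 C\<^sub>2 \<Longrightarrow> once_around G C\<^sub>1 u\<^sub>1 W\<^sub>1 \<Longrightarrow> once_around G C\<^sub>2 u\<^sub>2 W\<^sub>2 \<Longrightarrow>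
     circuit_walk G (C\<^sub>1 \<union> set (walk_edges P) \<union> C\<^sub>2) (None, W\<^sub>1 @ P @ W\<^sub>2 @ rev_walk P, None)"
| half_circle:
    "joined_figures G {h} u\<^sub>1 P u\<^sub>2 C\<^sub>2 \<Longrightarrow> half_edge G h \<Longrightarrow> once_around G C\<^sub>2 u\<^sub>2 W\<^sub>2 \<Longrightarrow>
     circuit_walk G ({h} \<union> set (walk_edges P) \<union> C\<^sub>2) (Some h, P @ W\<^sub>2 @ rev_walk P, Some h)"
| half_half:
    "joined_figures G {h\<^sub>1} u\<^sub>1 P u\<^sub>2 {h\<^sub>2} \<Longrightarrow> half_edge G h\<^sub>1 \<Longrightarrow> half_edge G h\<^sub>2 \<Longrightarrow>
     circuit_walk G ({h\<^sub>1} \<union> set (walk_edges P) \<union> {h\<^sub>2}) (Some h\<^sub>1, P, Some h\<^sub>2)"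

text \<open>
  The gain of a sign circuit depends on the chosen circuit walk, but only up to sign; it is
  therefore a relation, and neutrality does not depend on the choice.
\<close>

inductive circuit_gain :: "('v, 'e, 'k :: field) gain_sgraph \<Rightarrow> 'e set \<Rightarrow> 'k \<Rightarrow> bool"
  for G where
  loose: "loose_edge G e \<Longrightarrow> circuit_gain G {e} (gain G e)"
| walk: "circuit_walk G C W \<Longrightarrow> circuit_gain G C (ultrawalk_gain G W)"

definition neutral_circuit :: "('v, 'e, 'k :: field) gain_sgraph \<Rightarrow> 'e set \<Rightarrow> bool" where
  "neutral_circuit G C \<longleftrightarrow> sign_circuit G C \<and> (\<forall>g. circuit_gain G C g \<longrightarrow> g = 0)"

definition hyperbalanced :: "('v, 'e, 'k :: field) gain_sgraph \<Rightarrow> 'e set \<Rightarrow> bool" where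
  "hyperbalanced G S \<longleftrightarrow> (\<forall>C. C \<subseteq> S \<and> sign_circuit G C \<longrightarrow> neutral_circuit G C)"

definition sign_balanced :: "('v, 'e, 'k) gain_sgraph \<Rightarrow> 'e set \<Rightarrow> bool" where
  "sign_balanced G S \<longleftrightarrow>
     (\<forall>C. C \<subseteq> S \<longrightarrow> \<not> negative_circle G C) \<and> (\<forall>h\<in>S. \<not> half_edge G h)"

definition components :: "('v, 'e, 'k) gain_sgraph \<Rightarrow> 'e set \<Rightarrow> 'v set set" where
  "components G S = verts G // connected_in G S"

definition component_edges :: "('v, 'e, 'k) gain_sgraph \<Rightarrow> 'e set \<Rightarrow> 'v set \<Rightarrow> 'e set" where
  "component_edges G S X = {e \<in> S. ends G e \<noteq> [] \<and> set (ends G e) \<subseteq> X}"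

definition balanced_components :: "('v, 'e, 'k) gain_sgraph \<Rightarrow> 'e set \<Rightarrow> nat" where
  "balanced_components G S =
     card {X \<in> components G S. sign_balanced G (component_edges G S X)}"

section \<open>The extended ground set and the rank formula\<close>

text \<open>\<open>E\<^sub>\<infinity>\<close> is modelled in \<open>'e option\<close>, with \<open>None\<close> for the extra element \<open>e\<^sub>\<infinity>\<close>.\<close>

definition extended_edges :: "('v, 'e, 'k) gain_sgraph \<Rightarrow> 'e option set" where
  "extended_edges G = insert None (Some ` edges G)"

definition hyperfrustration :: "('v, 'e, 'k :: field) gain_sgraph \<Rightarrow> 'e option set \<Rightarrow> int" where
  "hyperfrustration G S = (if None \<notin> S \<and> hyperbalanced G (Some -` S) then 0 else 1)"

definition graph_rank :: "('v, 'e, 'k :: field) gain_sgraph \<Rightarrow> 'e option set \<Rightarrow> int" where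
  "graph_rank G S =
     int (card (verts G)) - int (balanced_components G (Some -` S)) + hyperfrustration G S"

section \<open>Matroids\<close>

definition matroid :: "'a set \<Rightarrow> 'a set set \<Rightarrow> bool" where
  "matroid E I \<longleftrightarrow> finite E \<and> (\<forall>X\<in>I. X \<subseteq> E) \<and> {} \<in> I
     \<and> (\<forall>X\<in>I. \<forall>Y. Y \<subseteq> X \<longrightarrow> Y \<in> I)
     \<and> (\<forall>X\<in>I. \<forall>Y\<in>I. card X < card Y \<longrightarrow> (\<exists>y\<in>Y - X. insert y X \<in> I))"

definition matroid_rank :: "'a set set \<Rightarrow> 'a set \<Rightarrow> nat" where
  "matroid_rank I S = Max (card ` {X \<in> I. X \<subseteq> S})"

definition is_matroid_rank_function :: "'a set \<Rightarrow> ('a set \<Rightarrow> int) \<Rightarrow> bool" where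
  "is_matroid_rank_function E r \<longleftrightarrow>
     (\<exists>I. matroid E I \<and> (\<forall>S\<subseteq>E. r S = int (matroid_rank I S)))"

section \<open>The vector model\<close>

text \<open>
  Coordinates are indexed by \<open>'v option\<close>: \<open>None\<close> is the coordinate 0 and \<open>Some v\<close> that of the
  vertex \<open>v\<close>.  The space of functions vanishing outside \<open>insert None (Some ` verts G)\<close> is
  \<open>\<bbbK>\<^sup>1\<^sup>+\<^sup>n\<close>; it contains all the vectors \<open>zvec G e\<close>, and dimensions of spans do not depend on the
  ambient space.
\<close>

definition fscale :: "'k :: field \<Rightarrow> ('i \<Rightarrow> 'k) \<Rightarrow> ('i \<Rightarrow> 'k)" where
  "fscale c f = (\<lambda>x. c * f x)"

global_interpretation fspace: vector_space "fscale :: 'k :: field \<Rightarrow> ('i \<Rightarrow> 'k) \<Rightarrow> ('i \<Rightarrow> 'k)"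
  by unfold_locales (auto simp: fscale_def fun_eq_iff algebra_simps)

definition basis_vec :: "'i \<Rightarrow> ('i \<Rightarrow> 'k :: field)" where
  "basis_vec i = (\<lambda>x. if x = i then 1 else 0)"

fun zvec :: "('v, 'e, 'k :: field) gain_sgraph \<Rightarrow> 'e option \<Rightarrow> ('v option \<Rightarrow> 'k)" where
  "zvec G None = basis_vec None"
| "zvec G (Some e) =
     fscale (gain G e) (basis_vec None)
     + (\<Sum>i<length (ends G e). fscale (of_int (orient G e i)) (basis_vec (Some (ends G e ! i))))"

end

(* Write e_0 for the vector z(e_infinity).  Along a walk W from u to v a signed combination of the
   vectors of its edges telescopes to phi(W) e_0 - e_u + sigma(W) e_v.  Applied to circuit walks this
   puts phi(C) e_0 into the span of C, so e_0 lies in the span of every hyperfrustrated set.  Conversely,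
   let e_0 lie in the span of S and take D minimal in S with this property, so that e_0 is a combination
   of the vectors of D with all coefficients nonzero.  Off coordinate 0 this is a linear relation with
   full support, so D has no leaves, and extending paths in D until they close up produces a sign circuit;
   if it were neutral, its circuit walk would express one vector of D by the others, against minimality.
   Finally, the span of e_0 and S has a basis formed by e_0 and the vectors e_v - t(v) e_r, where r is the
   root of the component of v, t is a switching function on balanced components and t = 0 on the others;
   only the roots of balanced components drop out, so its dimension is 1 + n - b(S). *)
theory Submission
  imports Defs
begin

section \<open>Walks\<close>

text \<open>A \<open>circle\<close> is an edge set that is connected and 2-regular, whereas gains
  and spans are computed along walks. Circuits built in the proof therefore come with a
  \<open>cycle_walk\<close>, hyperfrustration already supplies a circuit walk of nonzero gain, and a
  given negative circle in an unbalanced component is handled by counting degrees against a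
  switching function. The obstacle in the search for a circuit is that an isolated negative circle
  has no leaves and yet contains no sign circuit. It is excluded because its vectors are independent
  off coordinate 0. This is one of three places where 2 must be nonzero. In the second, the circuit
  walk of a half edge joined to a circle uses the half edge twice; in the third, a negative closed
  walk at v yields only -2 e_v. The search starts from a half edge whenever there is one, so that in
  a mixed handcuff the half edge comes first, as its circuit walk requires. The matroid axioms are
  not checked on the rank formula: once it equals the dimension of the span, it is the rank function
  of the vector matroid of \<open>zvec\<close>.\<close>

lemma walk_sign_Nil [simp]: "walk_sign G [] = 1"
  by (simp add: walk_sign_def walk_edges_def)

lemma walk_sign_Cons [simp]: "walk_sign G (d # W) = esign G (fst d) * walk_sign G W"
  by (simp add: walk_sign_def walk_edges_def)

lemma walk_sign_append [simp]: "walk_sign G (W @ W') = walk_sign G W * walk_sign G W'"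
  by (induction W) auto

lemma walk_gain_Nil [simp]: "walk_gain G [] = 0"
  by (simp add: walk_gain_def)

text \<open>The sign of every later prefix contains the sign of the first edge, so that factor comes
  out of the rest of the sum. This recursion replaces the indexed sum in later inductions.\<close>

lemma walk_gain_Cons [simp]:
  "walk_gain G (d # W) =
     - gain G (fst d) * of_int (orient G (fst d) (snd d)) + of_int (esign G (fst d)) * walk_gain G W"
proof -
  have "(\<Sum>j<length (d # W). gain G (fst ((d # W) ! j)) * of_int (walk_sign G (take j (d # W)))
                       * of_int (orient G (fst ((d # W) ! j)) (snd ((d # W) ! j))))
    = gain G (fst d) * of_int (orient G (fst d) (snd d)) + of_int (esign G (fst d)) *
     (\<Sum>j<length W. gain G (fst (W ! j)) * of_int (walk_sign G (take j W))
                       * of_int (orient G (fst (W ! j)) (snd (W ! j))))"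
    unfolding length_Cons sum.lessThan_Suc_shift
    by (simp add: sum_distrib_left algebra_simps)
  then show ?thesis
    unfolding walk_gain_def by (simp add: algebra_simps)
qed

lemma walk_edges_simps [simp]:
  "walk_edges [] = []" "walk_edges (d # W) = fst d # walk_edges W"
  "walk_edges (W @ W') = walk_edges W @ walk_edges W'"
  by (auto simp: walk_edges_def)

lemma walk_verts_simps [simp]:
  "walk_verts G u [] = [u]" "walk_verts G u (d # W) = u # walk_verts G (head G d) W"
  "walk_verts G u (W @ W') = walk_verts G u W @ map (head G) W'"
  by (auto simp: walk_verts_def)

lemma set_walk_verts: "set (walk_verts G u W) = insert u (head G ` set W)"
  by (simp add: walk_verts_def)

definition rev_step :: "'e step \<Rightarrow> 'e step" where
  "rev_step d = (fst d, 1 - snd d)"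

lemma fst_rev_step [simp]: "fst (rev_step d) = fst d"
  by (simp add: rev_step_def)

lemma rev_walk_simps [simp]:
  "rev_walk [] = []" "rev_walk (d # W) = rev_walk W @ [rev_step d]"
  by (auto simp: rev_walk_def rev_step_def case_prod_beta)

lemma set_walk_edges_rev_walk [simp]: "set (walk_edges (rev_walk W)) = set (walk_edges W)"
  by (induction W) auto

lemma walk_sign_rev_walk [simp]: "walk_sign G (rev_walk W) = walk_sign G W"
  by (induction W) auto

lemma end_in_walk_verts: "walk G u W v \<Longrightarrow> v \<in> set (walk_verts G u W)"
  by (induction W arbitrary: u) auto

text \<open>Heads are listed instead of all vertices because the start vertex is the last head.
  Distinctness of the edges excludes going along a link and straight back.\<close>

definition cycle_walk :: "('v, 'e, 'k) gain_sgraph \<Rightarrow> 'v \<Rightarrow> 'e step list \<Rightarrow> bool" where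
  "cycle_walk G u W \<longleftrightarrow> walk G u W u \<and> W \<noteq> [] \<and> distinct (map (head G) W) \<and> distinct (walk_edges W)"

lemma cycle_walkD:
  assumes "cycle_walk G u W"
  shows "walk G u W u" "W \<noteq> []" "distinct (map (head G) W)" "distinct (walk_edges W)"
  using assms by (auto simp: cycle_walk_def)

text \<open>The value on the vector of \<open>e\<close> of the linear functional with coordinates \<open>\<eta>\<close>, ignoring coordinate 0.\<close>

definition end_sum :: "('v, 'e, 'k :: field) gain_sgraph \<Rightarrow> ('v \<Rightarrow> 'k) \<Rightarrow> 'e \<Rightarrow> 'k" where
  "end_sum G \<eta> e = (\<Sum>i<length (ends G e). of_int (orient G e i) * \<eta> (ends G e ! i))"

lemma end_sum_cong:
  "(\<And>v. v \<in> set (ends G e) \<Longrightarrow> \<eta> v = \<theta> v) \<Longrightarrow> end_sum G \<eta> e = end_sum G \<theta> e"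
  unfolding end_sum_def by (intro sum.cong) auto

lemma end_sum_eq_0: "(\<And>v. v \<in> set (ends G e) \<Longrightarrow> \<eta> v = 0) \<Longrightarrow> end_sum G \<eta> e = 0"
  unfolding end_sum_def by (intro sum.neutral) auto

lemma sum_apply: "(\<Sum>i\<in>A. f i) x = (\<Sum>i\<in>A. f i x)"
  by (induction A rule: infinite_finite_induct) auto

lemma zvec_None: "zvec G (Some e) None = gain G e"
  by (simp add: fscale_def basis_vec_def sum_apply)

lemma zvec_Some: "zvec G (Some e) (Some v) = end_sum G (\<lambda>w. if w = v then 1 else 0) e"
  by (auto simp add: fscale_def basis_vec_def sum_apply end_sum_def intro!: sum.cong)

context gain_signed_graph
begin

lemma step_cases:
  assumes "is_step G d"
  obtains e a b where "ends G e = [a, b]" "d = (e, 0)" "tail G d = a" "head G d = b"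
    | e a b where "ends G e = [a, b]" "d = (e, 1)" "tail G d = b" "head G d = a"
proof -
  obtain e i where d: "d = (e, i)" by force
  from assms have "length (ends G e) = 2" and i: "i < 2"
    by (auto simp: is_step_def link_or_loop_def d)
  then obtain a b where ab: "ends G e = [a, b]"
    by (metis (no_types, opaque_lifting) One_nat_def Suc_1 length_0_conv length_Suc_conv)
  from i have "i = 0 \<or> i = 1" by auto
  then show thesis
    using that ab by (auto simp: d tail_def head_def)
qed

lemma step_link_or_loop: "is_step G d \<Longrightarrow> link_or_loop G (fst d)"
  by (simp add: is_step_def)

lemma step_edges: "is_step G d \<Longrightarrow> fst d \<in> edges G"
  by (simp add: is_step_def link_or_loop_def)

lemma set_ends_step: "is_step G d \<Longrightarrow> set (ends G (fst d)) = {tail G d, head G d}"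
  by (erule step_cases) auto

lemma step_verts:
  assumes "is_step G d"
  shows "tail G d \<in> verts G" "head G d \<in> verts G"
  using ends_verts[OF step_edges[OF assms]] set_ends_step[OF assms] by auto

lemma esign_square: "e \<in> edges G \<Longrightarrow> esign G e * esign G e = 1"
  using esign_values[of e] by auto

lemma orient_square:
  "e \<in> edges G \<Longrightarrow> i < length (ends G e) \<Longrightarrow> (of_int (orient G e i) :: 'k) * of_int (orient G e i) = 1"
  using orient_values[of e i] by auto

lemma orient_nonzero:
  "e \<in> edges G \<Longrightarrow> i < length (ends G e) \<Longrightarrow> (of_int (orient G e i) :: 'k) \<noteq> 0"
  using orient_values[of e i] by auto

lemma step_orient_square:
  "is_step G d \<Longrightarrow> (of_int (orient G (fst d) (snd d)) :: 'k) * of_int (orient G (fst d) (snd d)) = 1"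
  by (intro orient_square) (auto simp: is_step_def link_or_loop_def)

lemma step_orient_values: "is_step G d \<Longrightarrow> orient G (fst d) (snd d) \<in> {1, -1}"
  by (intro orient_values) (auto simp: is_step_def link_or_loop_def)

lemma step_orient_opposite:
  assumes "is_step G d"
  shows "orient G (fst d) (1 - snd d) = - esign G (fst d) * orient G (fst d) (snd d)"
proof -
  have "orient G (fst d) 0 * orient G (fst d) 1 = - esign G (fst d)"
    using assms orient_esign by (simp add: is_step_def)
  moreover have "orient G (fst d) 0 \<in> {1, -1}" "orient G (fst d) 1 \<in> {1, -1}"
    using assms orient_values[of "fst d" 0] orient_values[of "fst d" 1]
    by (auto simp: is_step_def link_or_loop_def)
  moreover have "snd d = 0 \<or> snd d = 1"
    using assms by (auto simp: is_step_def)
  ultimately show ?thesis by auto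
qed

text \<open>The bracket vanishes exactly when \<eta> is multiplied by the sign of the edge along the
  step. This is how switching functions act as test functionals.\<close>

lemma end_sum_step:
  assumes "is_step G d"
  shows "end_sum G \<eta> (fst d) = of_int (orient G (fst d) (snd d)) *
    (\<eta> (tail G d) - of_int (esign G (fst d)) * \<eta> (head G d))"
proof -
  have "end_sum G \<eta> (fst d) = of_int (orient G (fst d) (snd d)) * \<eta> (tail G d)
    + of_int (orient G (fst d) (1 - snd d)) * \<eta> (head G d)"
    using assms
    by (cases rule: step_cases) (auto simp: end_sum_def numeral_2_eq_2)
  then show ?thesis
    unfolding step_orient_opposite[OF assms] by (simp add: algebra_simps)
qed

lemma end_sum_half_edge:
  assumes "half_edge G h"
  shows "end_sum G \<eta> h = of_int (orient G h 0) * \<eta> (hd (ends G h))"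
  using assms by (auto simp: half_edge_def end_sum_def length_Suc_conv)

lemma is_step_rev: "is_step G d \<Longrightarrow> is_step G (rev_step d)"
  by (auto simp: is_step_def rev_step_def)

lemma tail_rev [simp]: "tail G (rev_step d) = head G d"
  by (auto simp: tail_def head_def rev_step_def)

lemma head_rev: "is_step G d \<Longrightarrow> head G (rev_step d) = tail G d"
  by (auto simp: tail_def head_def is_step_def rev_step_def)

lemma walk_verts_in:
  assumes "walk G u W v"
  shows "u \<in> verts G" "v \<in> verts G"
  using assms by (induction W arbitrary: u) (auto simp: step_verts)

lemma walk_append:
  "walk G u (W @ W') v \<longleftrightarrow> (\<exists>w. walk G u W w \<and> walk G w W' v)"
proof (induction W arbitrary: u)
  case Nil
  then show ?case using walk_verts_in(1)[of u W' v] by auto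
qed auto

lemma walk_step: "is_step G d \<Longrightarrow> walk G (tail G d) [d] (head G d)"
  by (simp add: step_verts)

lemma walk_snoc:
  "walk G u (W @ [d]) v \<longleftrightarrow> walk G u W (tail G d) \<and> is_step G d \<and> head G d = v"
  by (auto simp: walk_append step_verts)

lemma walk_rev_walk: "walk G u W v \<Longrightarrow> walk G v (rev_walk W) u"
  by (induction W arbitrary: u) (auto simp: walk_snoc head_rev is_step_rev)

lemma walk_verts_rev_walk:
  "walk G u W v \<Longrightarrow> walk_verts G v (rev_walk W) = rev (walk_verts G u W)"
  by (induction W arbitrary: u) (auto simp: head_rev)

lemma walk_steps: "walk G u W v \<Longrightarrow> d \<in> set W \<Longrightarrow> is_step G d"
  by (induction W arbitrary: u) auto

lemma walk_tails: "walk G u W v \<Longrightarrow> d \<in> set W \<Longrightarrow> tail G d \<in> set (walk_verts G u W)"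
  by (induction W arbitrary: u) auto

lemma walk_edge_link_or_loop: "walk G u W v \<Longrightarrow> e \<in> set (walk_edges W) \<Longrightarrow> link_or_loop G e"
  by (induction W arbitrary: u) (auto simp: is_step_def)

lemma ends_walk_edge:
  assumes "walk G u W v" "e \<in> set (walk_edges W)"
  shows "set (ends G e) \<subseteq> set (walk_verts G u W)"
  using assms
proof (induction W arbitrary: u)
  case (Cons d W)
  then show ?case by (auto simp: set_ends_step set_walk_verts)
qed auto

lemma walk_sign_square: "walk G u W v \<Longrightarrow> walk_sign G W * walk_sign G W = 1"
proof (induction W arbitrary: u)
  case (Cons d W)
  then have "esign G (fst d) \<in> {1, -1}" "walk_sign G W * walk_sign G W = 1"
    using step_edges[of d] esign_values[of "fst d"] by auto
  then show ?case by auto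
qed auto

lemma walk_sign_values:
  assumes "walk G u W v"
  shows "walk_sign G W = 1 \<or> walk_sign G W = -1"
  using walk_sign_square[OF assms] by (metis square_eq_1_iff)

lemma path_distinct_edges:
  assumes "walk G u W v" "distinct (walk_verts G u W)"
  shows "distinct (walk_edges W)"
  using assms
proof (induction W arbitrary: u)
  case (Cons d W)
  have "tail G d \<in> set (ends G (fst d))"
    using Cons.prems by (simp add: set_ends_step)
  then have "fst d \<notin> set (walk_edges W)"
    using Cons.prems ends_walk_edge[of "head G d" W v "fst d"] by auto
  then show ?case using Cons by auto
qed auto

lemma end_step:
  assumes "e \<in> edges G" "i < length (ends G e)" "\<not> half_edge G e"
  shows "is_step G (e, i)" "tail G (e, i) = ends G e ! i"
proof -
  have "length (ends G e) = 2"
    using assms length_ends[of e] by (auto simp: half_edge_def)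
  then show "is_step G (e, i)" "tail G (e, i) = ends G e ! i"
    using assms by (auto simp: is_step_def link_or_loop_def tail_def)
qed

section \<open>Cycles\<close>

text \<open>Every inner visit of \<open>x\<close> arrives once and leaves once; only the two ends of
  the walk disturb the balance, and for a closed walk they cancel.\<close>

lemma walk_tail_head_count:
  assumes "walk G u W v"
  shows "count_list (map (tail G) W) x + of_bool (v = x) = of_bool (u = x) + count_list (map (head G) W) x"
  using assms
proof (induction W arbitrary: u)
  case (Cons d W)
  then have "walk G (head G d) W v" by simp
  from Cons.IH[OF this] Cons.prems show ?case by (auto split: if_splits)
qed auto

lemma count_ends_step:
  "is_step G d \<Longrightarrow> count_list (ends G (fst d)) x = of_bool (tail G d = x) + of_bool (head G d = x)"
  by (erule step_cases) auto

lemma vset_walk: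
  assumes "walk G u W v" "W \<noteq> []"
  shows "vset G (set (walk_edges W)) = set (walk_verts G u W)"
proof -
  have "vset G (set (walk_edges W)) = tail G ` set W \<union> head G ` set W"
    using set_ends_step[OF walk_steps[OF assms(1)]] by (auto simp: vset_def walk_edges_def)
  moreover have "u \<in> tail G ` set W"
    using assms by (cases W) auto
  moreover have "tail G ` set W \<subseteq> insert u (head G ` set W)"
    using walk_tails[OF assms(1)] by (auto simp: set_walk_verts)
  ultimately show ?thesis by (auto simp: set_walk_verts)
qed

lemma degree_walk:
  assumes "walk G u W v" "distinct (walk_edges W)"
  shows "degree G (set (walk_edges W)) x = count_list (map (tail G) W) x + count_list (map (head G) W) x"
proof -
  have "degree G (set (walk_edges W)) x = (\<Sum>e\<leftarrow>walk_edges W. count_list (ends G e) x)"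
    unfolding degree_def using assms(2) by (simp add: sum_list_distinct_conv_sum_set)
  also have "\<dots> = (\<Sum>d\<leftarrow>W. of_bool (tail G d = x) + of_bool (head G d = x))"
    unfolding walk_edges_def map_map using walk_steps[OF assms(1)]
    by (intro arg_cong[where f = sum_list] map_cong) (auto simp: count_ends_step)
  also have "\<dots> = count_list (map (tail G) W) x + count_list (map (head G) W) x"
    by (induction W) auto
  finally show ?thesis .
qed

lemma walk_connected:
  assumes "walk G u W v" "set (walk_edges W) \<subseteq> S"
  shows "(u, v) \<in> connected_in G S"
proof -
  have "(u, v) \<in> (adjacency G S)\<^sup>*"
    using assms
  proof (induction W arbitrary: u)
    case (Cons d W)
    then have "link_or_loop G (fst d)" "set (ends G (fst d)) = {u, head G d}" "fst d \<in> S"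
      using step_link_or_loop[of d] set_ends_step[of d] by auto
    then have "(u, head G d) \<in> adjacency G S"
      unfolding adjacency_def by blast
    moreover have "(head G d, v) \<in> (adjacency G S)\<^sup>*"
      using Cons by auto
    ultimately show ?case by (rule converse_rtrancl_into_rtrancl)
  qed auto
  with walk_verts_in[OF assms(1)] show ?thesis by (simp add: connected_in_def)
qed

lemma count_list_distinct: "distinct xs \<Longrightarrow> count_list xs x = of_bool (x \<in> set xs)"
  by (induction xs) auto

lemma connected_in_sym: "(u, v) \<in> connected_in G S \<Longrightarrow> (v, u) \<in> connected_in G S"
proof -
  have "sym (adjacency G S)" by (auto simp: sym_def adjacency_def insert_commute)
  then show "(u, v) \<in> connected_in G S \<Longrightarrow> (v, u) \<in> connected_in G S"
    by (auto simp: connected_in_def dest: symD[OF sym_rtrancl])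
qed

lemma connected_in_trans:
  "(u, v) \<in> connected_in G S \<Longrightarrow> (v, w) \<in> connected_in G S \<Longrightarrow> (u, w) \<in> connected_in G S"
  by (auto simp: connected_in_def)

lemma cycle_walk_base: "cycle_walk G u W \<Longrightarrow> u \<in> head G ` set W"
  by (cases W rule: rev_cases) (auto simp: cycle_walk_def walk_snoc)

lemma vset_cycle: "cycle_walk G u W \<Longrightarrow> vset G (set (walk_edges W)) = head G ` set W"
  using vset_walk[of u W u] cycle_walk_base[of u W]
  by (auto simp: cycle_walk_def set_walk_verts)

lemma walk_reaches:
  assumes "walk G u W v" "x \<in> set (walk_verts G u W)"
  obtains A B where "W = A @ B" "walk G u A x" "walk G x B v"
  using assms
proof (induction W arbitrary: u thesis)
  case Nil
  show ?case using Nil(1)[of "[]" "[]"] Nil(2,3) by auto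
next
  case (Cons d W)
  show ?case
  proof (cases "x = u")
    case True
    show ?thesis using Cons.prems(1)[of "[]" "d # W"] Cons.prems True walk_verts_in[OF Cons.prems(2)] by simp
  next
    case False
    then have "walk G (head G d) W v" "x \<in> set (walk_verts G (head G d) W)"
      using Cons.prems by auto
    then obtain A B where "W = A @ B" "walk G (head G d) A x" "walk G x B v"
      using Cons.IH by blast
    then show ?thesis using Cons.prems(1)[of "d # A" B] Cons.prems(2) by auto
  qed
qed

text \<open>Each vertex is the head of exactly one step, hence by balance the tail of exactly one,
  which gives degree 2 (also for a single loop). Connectivity goes through the base vertex
  \<open>u\<close>.\<close>

lemma cycle_walk_circle:
  assumes "cycle_walk G u W"
  shows "circle G (set (walk_edges W))"
proof -
  let ?C = "set (walk_edges W)"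
  note W = cycle_walkD[OF assms]
  have deg: "degree G ?C x = 2" if "x \<in> vset G ?C" for x
  proof -
    have "count_list (map (head G) W) x = 1"
      using count_list_distinct[OF W(3)] that vset_cycle[OF assms] by auto
    with walk_tail_head_count[OF W(1), of x] degree_walk[OF W(1,4), of x] show ?thesis by simp
  qed
  have con: "(u, x) \<in> connected_in G ?C" if "x \<in> vset G ?C" for x
  proof -
    have "x \<in> set (walk_verts G u W)"
      using that vset_walk[OF W(1,2)] by simp
    then obtain A B where "W = A @ B" "walk G u A x"
      using walk_reaches[OF W(1)] by blast
    then show ?thesis using walk_connected[of u A x ?C] by simp
  qed
  have "(x, y) \<in> connected_in G ?C" if "x \<in> vset G ?C" "y \<in> vset G ?C" for x y
    using connected_in_trans[OF connected_in_sym[OF con[OF that(1)]] con[OF that(2)]] .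
  moreover have "?C \<noteq> {}" using W(2) by (simp add: walk_edges_def)
  ultimately show ?thesis
    unfolding circle_def using deg walk_edge_link_or_loop[OF W(1)] by blast
qed

lemma cycle_walk_once_around: "cycle_walk G u W \<Longrightarrow> once_around G (set (walk_edges W)) u W"
  by (simp add: once_around_def cycle_walk_circle cycle_walkD)

lemma set_sign_walk: "distinct (walk_edges W) \<Longrightarrow> set_sign G (set (walk_edges W)) = walk_sign G W"
  by (simp add: set_sign_def walk_sign_def prod.distinct_set_conv_list)

lemma once_around_sign: "once_around G C u W \<Longrightarrow> walk_sign G W = set_sign G C"
  using set_sign_walk[of W] by (auto simp: once_around_def)

lemma cycle_walk_rotate:
  assumes "cycle_walk G u W" "x \<in> head G ` set W"
  obtains W' where "cycle_walk G x W'" "set (walk_edges W') = set (walk_edges W)"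
    "walk_sign G W' = walk_sign G W"
proof -
  note W = cycle_walkD[OF assms(1)]
  have "x \<in> set (walk_verts G u W)" using assms(2) by (auto simp: set_walk_verts)
  then obtain A B where AB: "W = A @ B" "walk G u A x" "walk G x B u"
    using walk_reaches[OF W(1)] by blast
  have "walk G x (B @ A) x"
    using AB(2,3) by (meson walk_append)
  then have "cycle_walk G x (B @ A)"
    using W(2-4) by (auto simp: cycle_walk_def AB(1))
  then show thesis
    by (rule that) (auto simp: AB)
qed

lemma path_close:
  assumes "walk G u P v" "distinct (walk_verts G u P)" "is_step G d" "tail G d = v" "head G d = u"
    "fst d \<notin> set (walk_edges P)"
  shows "cycle_walk G u (P @ [d])"
  using assms path_distinct_edges[OF assms(1,2)]
  by (auto simp: cycle_walk_def walk_snoc walk_verts_def)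

text \<open>Two paths meeting only at their ends can still share an edge, namely when both consist
  of the same single edge; hence the separate condition on edges.\<close>

lemma path_join:
  assumes P: "walk G u P v" "distinct (walk_verts G u P)"
    and Q: "walk G v Q u" "distinct (walk_verts G v Q)"
    and "u \<noteq> v"
    and disj: "set (walk_verts G u P) \<inter> set (walk_verts G v Q) \<subseteq> {u, v}"
      "set (walk_edges P) \<inter> set (walk_edges Q) = {}"
  shows "cycle_walk G u (P @ Q)"
proof -
  have "P \<noteq> []" using P(1) assms(5) by auto
  moreover have "head G ` set P \<inter> head G ` set Q = {}"
    using P(2) Q(2) disj(1) by (auto simp: walk_verts_def)
  moreover have "walk G u (P @ Q) u"
    using P(1) Q(1) by (meson walk_append)
  ultimately show ?thesis
    using P(2) Q(2) disj(2) path_distinct_edges[OF P] path_distinct_edges[OF Q]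
    by (auto simp: cycle_walk_def walk_verts_def)
qed

end

section \<open>Walks in the vector model\<close>

lemma fscale_apply: "fscale c f x = c * f x"
  by (simp add: fscale_def)

lemma two_nonzero:
  assumes "CHAR('k::field) \<noteq> 2"
  shows "(2 :: 'k) \<noteq> 0"
proof
  assume "(2 :: 'k) = 0"
  then have "(of_nat 2 :: 'k) = 0" by simp
  then have "CHAR('k) dvd 2" by (simp only: of_nat_eq_0_iff_char_dvd)
  then have "CHAR('k) \<le> 2" by (rule dvd_imp_le) simp
  moreover have "CHAR('k) \<noteq> 0" using \<open>CHAR('k) dvd 2\<close> by (intro notI) simp
  moreover have "CHAR('k) \<noteq> 1" by simp
  ultimately show False using assms by linarith
qed

definition edge_vectors :: "('v, 'e, 'k :: field) gain_sgraph \<Rightarrow> 'e set \<Rightarrow> ('v option \<Rightarrow> 'k) set" where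
  "edge_vectors G S = (\<lambda>e. zvec G (Some e)) ` S"

lemma edge_vectors_mono: "S \<subseteq> T \<Longrightarrow> edge_vectors G S \<subseteq> edge_vectors G T"
  by (auto simp: edge_vectors_def)

lemma zvec_in_span: "e \<in> S \<Longrightarrow> zvec G (Some e) \<in> fspace.span (edge_vectors G S)"
  by (auto simp: edge_vectors_def intro!: fspace.span_base)

definition walk_vec ::
  "('v, 'e, 'k :: field) gain_sgraph \<Rightarrow> 'v \<Rightarrow> 'e step list \<Rightarrow> 'v \<Rightarrow> ('v option \<Rightarrow> 'k)" where
  "walk_vec G u W v = fscale (walk_gain G W) (basis_vec None) - basis_vec (Some u)
     + fscale (of_int (walk_sign G W)) (basis_vec (Some v))"

context gain_signed_graph
begin

lemma zvec_step:
  assumes "is_step G d"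
  shows "zvec G (Some (fst d)) = fscale (gain G (fst d)) (basis_vec None) +
    fscale (of_int (orient G (fst d) (snd d)))
      (basis_vec (Some (tail G d)) - fscale (of_int (esign G (fst d))) (basis_vec (Some (head G d))))"
proof
  fix x
  show "zvec G (Some (fst d)) x = (fscale (gain G (fst d)) (basis_vec None) +
    fscale (of_int (orient G (fst d) (snd d)))
      (basis_vec (Some (tail G d)) - fscale (of_int (esign G (fst d))) (basis_vec (Some (head G d))))) x"
    by (cases x)
       (auto simp del: zvec.simps simp: fscale_apply zvec_None zvec_Some end_sum_step[OF assms] basis_vec_def)
qed

lemma zvec_half_edge:
  assumes "half_edge G h"
  shows "zvec G (Some h) = fscale (gain G h) (basis_vec None) +
    fscale (of_int (orient G h 0)) (basis_vec (Some (hd (ends G h))))"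
proof
  fix x
  show "zvec G (Some h) x = (fscale (gain G h) (basis_vec None) +
    fscale (of_int (orient G h 0)) (basis_vec (Some (hd (ends G h))))) x"
    by (cases x)
       (auto simp del: zvec.simps simp: fscale_apply zvec_None zvec_Some end_sum_half_edge[OF assms] basis_vec_def)
qed

lemma zvec_loose_edge:
  assumes "loose_edge G e"
  shows "zvec G (Some e) = fscale (gain G e) (basis_vec None)"
  using assms by (auto simp: loose_edge_def)

lemma half_edge_orient_values: "half_edge G h \<Longrightarrow> orient G h 0 \<in> {1, -1}"
  by (intro orient_values) (auto simp: half_edge_def)

text \<open>As the end signs square to 1, the coefficient \<open>- orient\<close> produces -e at the
  tail and \<sigma> e at the head; the latter cancels against the start of the remaining
  walk.\<close>

lemma walk_vec_Cons:
  assumes "is_step G d"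
  shows "walk_vec G (tail G d) (d # W) v =
    fscale (- of_int (orient G (fst d) (snd d))) (zvec G (Some (fst d)))
    + fscale (of_int (esign G (fst d))) (walk_vec G (head G d) W v)"
  unfolding zvec_step[OF assms] walk_vec_def
  using step_orient_values[OF assms]
  by (auto simp: fun_eq_iff fscale_apply algebra_simps)

lemma walk_vec_span:
  assumes "walk G u W v"
  shows "walk_vec G u W v \<in> fspace.span (edge_vectors G (set (walk_edges W)))"
  using assms
proof (induction W arbitrary: u)
  case Nil
  then have "walk_vec G u [] v = 0"
    by (simp add: walk_vec_def fun_eq_iff fscale_apply)
  then show ?case by (metis fspace.span_zero)
next
  case (Cons d W)
  have "edge_vectors G (set (walk_edges W)) \<subseteq> edge_vectors G (set (walk_edges (d # W)))"
    by (rule edge_vectors_mono) auto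
  then have "walk_vec G (head G d) W v \<in> fspace.span (edge_vectors G (set (walk_edges (d # W))))"
    using Cons.IH[of "head G d"] Cons.prems fspace.span_mono by auto
  moreover have "zvec G (Some (fst d)) \<in> fspace.span (edge_vectors G (set (walk_edges (d # W))))"
    by (rule zvec_in_span) simp
  ultimately have "walk_vec G (tail G d) (d # W) v \<in> fspace.span (edge_vectors G (set (walk_edges (d # W))))"
    using walk_vec_Cons[of d W v] Cons.prems
    by (metis walk.simps(2) fspace.span_add fspace.span_scale)
  then show ?case using Cons.prems by simp
qed

lemma walk_vec_in_span:
  assumes "walk G u W v" "set (walk_edges W) \<subseteq> S"
  shows "walk_vec G u W v \<in> fspace.span (edge_vectors G S)"
  using walk_vec_span[OF assms(1)] fspace.span_mono[OF edge_vectors_mono[OF assms(2)]] by auto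

lemma positive_closed_walk_gain:
  assumes "walk G u W u" "walk_sign G W = 1" "set (walk_edges W) \<subseteq> S"
  shows "fscale (walk_gain G W) (basis_vec None) \<in> fspace.span (edge_vectors G S)"
proof -
  have "walk_vec G u W u = fscale (walk_gain G W) (basis_vec None)"
    by (simp add: walk_vec_def assms(2) fun_eq_iff fscale_apply)
  then show ?thesis using walk_vec_in_span[OF assms(1,3)] by simp
qed

text \<open>The walk vector of a closed walk of sign 1 and gain 0 vanishes, so the telescoped
  relation can be solved for the first edge, which has coefficient 1 or -1. Edges in the rest may
  repeat, as they do on the path of a handcuff; in the applications only the first one must not
  recur.\<close>

lemma positive_closed_walk_dependency:
  assumes "walk G u (d # W) u" "walk_sign G (d # W) = 1" "walk_gain G (d # W) = 0"
    and "set (walk_edges W) \<subseteq> S"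
  shows "zvec G (Some (fst d)) \<in> fspace.span (edge_vectors G S)"
proof -
  have d: "is_step G d" "tail G d = u" "walk G (head G d) W u" using assms(1) by auto
  define \<tau> :: 'k where "\<tau> = of_int (orient G (fst d) (snd d))"
  define \<sigma> :: 'k where "\<sigma> = of_int (esign G (fst d))"
  have "walk_vec G u (d # W) u = 0"
    unfolding walk_vec_def assms(2,3) by (simp add: fun_eq_iff fscale_apply)
  then have "fscale (- \<tau>) (zvec G (Some (fst d))) + fscale \<sigma> (walk_vec G (head G d) W u) = 0"
    using walk_vec_Cons[OF d(1), of W u] d(2) by (simp add: \<tau>_def \<sigma>_def del: zvec.simps)
  then have "fscale \<tau> (zvec G (Some (fst d))) = fscale \<sigma> (walk_vec G (head G d) W u)"
    by (auto simp: fun_eq_iff fscale_apply simp del: zvec.simps)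
  then have "fscale \<tau> (fscale \<tau> (zvec G (Some (fst d)))) = fscale (\<tau> * \<sigma>) (walk_vec G (head G d) W u)"
    by (simp only: fspace.scale_scale)
  moreover have "fscale \<tau> (fscale \<tau> (zvec G (Some (fst d)))) = zvec G (Some (fst d))"
    using step_orient_square[OF d(1)]
    by (simp add: fun_eq_iff fscale_apply \<tau>_def del: zvec.simps flip: mult.assoc)
  ultimately show ?thesis
    using walk_vec_in_span[OF d(3) assms(4)] by (metis fspace.span_scale)
qed

lemma once_around_walk: "once_around G C u W \<Longrightarrow> walk G u W u" "once_around G C u W \<Longrightarrow> set (walk_edges W) = C"
  by (auto simp: once_around_def)

lemma half_edge_not_link_or_loop: "half_edge G h \<Longrightarrow> \<not> link_or_loop G h"
  by (auto simp: half_edge_def link_or_loop_def)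

section \<open>Circuit walks of handcuffs and their vectors\<close>

lemma negative_figure_once_around:
  assumes "negative_figure G F" "once_around G F u W"
  shows "walk_sign G W = -1"
proof -
  have "circle G F" using assms(2) by (simp add: once_around_def)
  then have "\<not> (\<exists>h. half_edge G h \<and> F = {h})"
    using half_edge_not_link_or_loop by (auto simp: circle_def)
  then have "set_sign G F = -1"
    using assms(1) by (auto simp: negative_figure_def negative_circle_def)
  then show ?thesis using once_around_sign[OF assms(2)] by simp
qed

lemma half_edge_ends: "half_edge G h \<Longrightarrow> set (ends G h) = {hd (ends G h)}"
  by (auto simp: half_edge_def length_Suc_conv)

lemma vset_half_edge: "half_edge G h \<Longrightarrow> vset G {h} = {hd (ends G h)}"
  using half_edge_ends by (simp add: vset_def)

lemma joined_half_edge: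
  assumes "joined_figures G {h} u P v F" "half_edge G h"
  shows "hd (ends G h) = u"
proof -
  have "u \<in> vset G {h}" using assms(1) unfolding joined_figures_def by blast
  then show ?thesis using vset_half_edge[OF assms(2)] by simp
qed

lemma joined_half_edges:
  assumes "joined_figures G {h} u P v {h'}" "half_edge G h'"
  shows "hd (ends G h') = v"
proof -
  \<comment> \<open>For an empty path the condition on the common vertex names only
    \<open>u\<close>, so the equality with \<open>v\<close> has to be read off the walk.\<close>
  have "P = [] \<Longrightarrow> u = v" using assms(1) by (auto simp: joined_figures_def path_def)
  then have "v \<in> vset G {h'}" using assms(1) unfolding joined_figures_def by blast
  then show ?thesis using vset_half_edge[OF assms(2)] by simp
qed

lemma joined_figures_walk: "joined_figures G F u P v F' \<Longrightarrow> walk G u P v"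
  by (auto simp: joined_figures_def path_def)

text \<open>Both circles contribute -1 and the path contributes its sign twice.\<close>

lemma circle_circle_walk:
  assumes "joined_figures G C\<^sub>1 u\<^sub>1 P u\<^sub>2 C\<^sub>2" "once_around G C\<^sub>1 u\<^sub>1 W\<^sub>1" "once_around G C\<^sub>2 u\<^sub>2 W\<^sub>2"
  shows "walk G u\<^sub>1 (W\<^sub>1 @ P @ W\<^sub>2 @ rev_walk P) u\<^sub>1" "walk_sign G (W\<^sub>1 @ P @ W\<^sub>2 @ rev_walk P) = 1"
proof -
  have P: "walk G u\<^sub>1 P u\<^sub>2" using assms(1) by (rule joined_figures_walk)
  have W: "walk G u\<^sub>1 W\<^sub>1 u\<^sub>1" "walk G u\<^sub>2 W\<^sub>2 u\<^sub>2"
    using assms(2,3) by (auto simp: once_around_def)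
  show "walk G u\<^sub>1 (W\<^sub>1 @ P @ W\<^sub>2 @ rev_walk P) u\<^sub>1"
    using W P walk_rev_walk[OF P] by (meson walk_append)
  have "negative_figure G C\<^sub>1" "negative_figure G C\<^sub>2"
    using assms(1) by (auto simp: joined_figures_def)
  then show "walk_sign G (W\<^sub>1 @ P @ W\<^sub>2 @ rev_walk P) = 1"
    using negative_figure_once_around assms(2,3) walk_sign_square[OF P] by simp
qed

text \<open>Here only one negative circle is traversed, so the sign is -1 and the walk vector
  contains -2 e_u. Twice the oriented half edge cancels this, and its gain terms are the two half
  edge terms of the ultrawalk.\<close>

lemma half_circle_walk:
  assumes "joined_figures G {h} u\<^sub>1 P u\<^sub>2 C\<^sub>2" "half_edge G h" "once_around G C\<^sub>2 u\<^sub>2 W\<^sub>2"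
  shows "walk G u\<^sub>1 (P @ W\<^sub>2 @ rev_walk P) u\<^sub>1" "walk_sign G (P @ W\<^sub>2 @ rev_walk P) = -1"
    and "fscale (ultrawalk_gain G (Some h, P @ W\<^sub>2 @ rev_walk P, Some h)) (basis_vec None) =
      walk_vec G u\<^sub>1 (P @ W\<^sub>2 @ rev_walk P) u\<^sub>1 + fscale (2 * of_int (orient G h 0)) (zvec G (Some h))"
proof -
  have P: "walk G u\<^sub>1 P u\<^sub>2" using assms(1) by (rule joined_figures_walk)
  have W: "walk G u\<^sub>2 W\<^sub>2 u\<^sub>2"
    using assms(3) by (auto simp: once_around_def)
  show "walk G u\<^sub>1 (P @ W\<^sub>2 @ rev_walk P) u\<^sub>1"
    using W P walk_rev_walk[OF P] by (meson walk_append)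
  have "negative_figure G C\<^sub>2"
    using assms(1) by (auto simp: joined_figures_def)
  then show sgn: "walk_sign G (P @ W\<^sub>2 @ rev_walk P) = -1"
    using negative_figure_once_around assms(3) walk_sign_square[OF P] by simp
  show "fscale (ultrawalk_gain G (Some h, P @ W\<^sub>2 @ rev_walk P, Some h)) (basis_vec None) =
      walk_vec G u\<^sub>1 (P @ W\<^sub>2 @ rev_walk P) u\<^sub>1 + fscale (2 * of_int (orient G h 0)) (zvec G (Some h))"
    unfolding zvec_half_edge[OF assms(2)] walk_vec_def sgn joined_half_edge[OF assms(1,2)]
      ultrawalk_gain.simps
    using half_edge_orient_values[OF assms(2)]
    by (auto simp: fun_eq_iff fscale_apply algebra_simps)
qed

text \<open>One half edge cancels the start vertex of the walk vector, the other, weighted by the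
  sign of the path, cancels its end vertex.\<close>

lemma half_half_walk:
  assumes "joined_figures G {h\<^sub>1} u\<^sub>1 P u\<^sub>2 {h\<^sub>2}" "half_edge G h\<^sub>1" "half_edge G h\<^sub>2"
  shows "fscale (ultrawalk_gain G (Some h\<^sub>1, P, Some h\<^sub>2)) (basis_vec None) =
      walk_vec G u\<^sub>1 P u\<^sub>2 + fscale (of_int (orient G h\<^sub>1 0)) (zvec G (Some h\<^sub>1))
      - fscale (of_int (walk_sign G P) * of_int (orient G h\<^sub>2 0)) (zvec G (Some h\<^sub>2))"
  unfolding zvec_half_edge[OF assms(2)] zvec_half_edge[OF assms(3)] walk_vec_def
    joined_half_edge[OF assms(1,2)] joined_half_edges[OF assms(1,3)] ultrawalk_gain.simps
  using half_edge_orient_values[OF assms(2)] half_edge_orient_values[OF assms(3)]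
  by (auto simp: fun_eq_iff fscale_apply algebra_simps)

lemma circuit_gain_in_span:
  assumes "circuit_gain G C g"
  shows "fscale g (basis_vec None) \<in> fspace.span (edge_vectors G C)"
  using assms
proof cases
  case (loose e)
  then show ?thesis
    using zvec_in_span[of e C G] zvec_loose_edge[of e] by (simp del: zvec.simps)
next
  case (walk W)
  from walk(2) show ?thesis
  proof cases
    case (positive_circle u W')
    have "walk_sign G W' = 1"
      using once_around_sign[OF positive_circle(3)] positive_circle(2) by (simp add: positive_circle_def)
    then show ?thesis
      using positive_closed_walk_gain[of u W' C] once_around_walk[OF positive_circle(3)]
      by (simp add: walk(1) positive_circle(1))
  next
    case (circle_circle C\<^sub>1 u\<^sub>1 P u\<^sub>2 C\<^sub>2 W\<^sub>1 W\<^sub>2)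
    show ?thesis
      using positive_closed_walk_gain[OF circle_circle_walk[OF circle_circle(3-5)], of C]
        once_around_walk(2)[OF circle_circle(4)] once_around_walk(2)[OF circle_circle(5)]
      by (auto simp: walk(1) circle_circle(1,2))
  next
    case (half_circle h u\<^sub>1 P u\<^sub>2 C\<^sub>2 W\<^sub>2)
    have "set (walk_edges (P @ W\<^sub>2 @ rev_walk P)) \<subseteq> C"
      using once_around_walk(2)[OF half_circle(5)] half_circle(1) by auto
    moreover have "h \<in> C" by (simp add: half_circle(1))
    ultimately show ?thesis
      unfolding walk(1) half_circle(2) half_circle_walk(3)[OF half_circle(3-5)]
      by (intro fspace.span_add fspace.span_scale zvec_in_span
            walk_vec_in_span[OF half_circle_walk(1)[OF half_circle(3-5)]])
  next
    case (half_half h\<^sub>1 u\<^sub>1 P u\<^sub>2 h\<^sub>2)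
    have "set (walk_edges P) \<subseteq> C" "h\<^sub>1 \<in> C" "h\<^sub>2 \<in> C"
      by (auto simp: half_half(1))
    then show ?thesis
      unfolding walk(1) half_half(2) half_half_walk[OF half_half(3-5)]
      by (intro fspace.span_add fspace.span_diff fspace.span_scale zvec_in_span
            walk_vec_in_span[OF joined_figures_walk[OF half_half(3)]])
  qed
qed

end

section \<open>Finding a sign circuit\<close>

text \<open>The condition is about ends and not edges, so a loop is a witness for itself: its other
  end lies at the same vertex.\<close>

definition leafless :: "('v, 'e, 'k) gain_sgraph \<Rightarrow> 'e set \<Rightarrow> bool" where
  "leafless G D \<longleftrightarrow> (\<forall>e\<in>D. \<forall>i<length (ends G e). \<exists>e'\<in>D. \<exists>j<length (ends G e').
     (e', j) \<noteq> (e, i) \<and> ends G e' ! j = ends G e ! i)"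

text \<open>
  If \<open>D\<close> is minimal among the sets spanning \<open>e\<^sub>0\<close>, such a circuit cannot be neutral.
\<close>

definition has_dependent_circuit :: "('v, 'e, 'k :: field) gain_sgraph \<Rightarrow> 'e set \<Rightarrow> bool" where
  "has_dependent_circuit G D \<longleftrightarrow> (\<exists>C W f. circuit_walk G C W \<and> C \<subseteq> D \<and> f \<in> D \<and>
     (ultrawalk_gain G W = 0 \<longrightarrow> zvec G (Some f) \<in> fspace.span (edge_vectors G (D - {f}))))"

context gain_signed_graph
begin

text \<open>
  \<open>F\<close> is a negative figure already found and \<open>X\<close> its vertex set, or \<open>F\<close> is empty and \<open>X\<close> is the start vertex.
\<close>

lemma extend_path:
  assumes D: "D \<subseteq> edges G" "leafless G D"
    and F: "\<forall>e\<in>F. set (ends G e) \<subseteq> X"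
    and W: "walk G x W v" "distinct (walk_verts G x W)" "set (walk_verts G x W) \<inter> X = {x}"
      "set (walk_edges W) \<subseteq> D - F"
    and e: "e \<in> D - F" "e \<notin> set (walk_edges W)" "i < length (ends G e)" "ends G e ! i = v"
  shows "\<exists>W' v'. walk G x W' v' \<and> distinct (walk_verts G x W') \<and> set (walk_verts G x W') \<inter> X = {x}
    \<and> set (walk_edges W') \<subseteq> D - F \<and> ((\<exists>h\<in>D - F. half_edge G h \<and> hd (ends G h) = v')
      \<or> (\<exists>d. is_step G d \<and> fst d \<in> D - F - set (walk_edges W') \<and> tail G d = v'
           \<and> head G d \<in> X \<union> set (walk_verts G x W')))"
  using W e
proof (induction "card (verts G) - length W" arbitrary: W v e i rule: less_induct)
  case less
  note W = less.prems(1-4) and e = less.prems(5-8)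
  show ?case
  proof (cases "half_edge G e")
    case True
    then have "hd (ends G e) = v"
      using e(3,4) by (auto simp: half_edge_def length_Suc_conv)
    then show ?thesis using True W e(1) by blast
  next
    case False
    define d where "d = (e, i)"
    have d: "is_step G d" "tail G d = v" "fst d = e"
      using end_step[OF _ e(3) False] e(1,4) D(1) by (auto simp: d_def)
    show ?thesis
    proof (cases "head G d \<in> X \<union> set (walk_verts G x W)")
      case True
      have "fst d \<in> D - F - set (walk_edges W)" using e(1,2) d(3) by simp
      then show ?thesis using True W d by blast
    next
      case False
      have v: "v \<in> set (walk_verts G x W)" using W(1) by (rule end_in_walk_verts)
      have W': "walk G x (W @ [d]) (head G d)" using W(1) d by (simp add: walk_snoc)
      have "set (walk_verts G x (W @ [d])) \<subseteq> verts G"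
        using walk_steps[OF W'] step_verts(2) walk_verts_in[OF W'] by (auto simp: set_walk_verts)
      moreover have dist: "distinct (walk_verts G x (W @ [d]))"
        using W(2) False by simp
      \<comment> \<open>A path has one vertex more than steps, so its length stays below the number
        of vertices and the truncated difference used as measure really drops.\<close>
      ultimately have "length (walk_verts G x (W @ [d])) \<le> card (verts G)"
        using finite_verts by (metis card_mono distinct_card)
      then have "card (verts G) - length (W @ [d]) < card (verts G) - length W"
        by (simp add: walk_verts_def)
      moreover note W' dist
      moreover have "set (walk_verts G x (W @ [d])) \<inter> X = {x}" using W(3) False by simp
      moreover have "set (walk_edges (W @ [d])) \<subseteq> D - F" using W(4) e(1) d(3) by simp
      moreover
      have i: "i < 2" "length (ends G e) = 2"
        using d(1) by (auto simp: d_def is_step_def link_or_loop_def)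
      then have "1 - i < length (ends G e)" by simp
      \<comment> \<open>Leaflessness is applied to the far end of \<open>e\<close>: another end at
        the new vertex continues the path.\<close>
      then obtain e' j where e': "e' \<in> D" "j < length (ends G e')" "(e', j) \<noteq> (e, 1 - i)"
          "ends G e' ! j = ends G e ! (1 - i)"
        using D(2) e(1) unfolding leafless_def by blast
      have hd: "ends G e ! (1 - i) = head G d" by (simp add: d_def head_def)
      have end': "head G d \<in> set (ends G e')" using e'(2,4) hd nth_mem by metis
      have "e' \<in> D - F" using F e'(1) end' False by blast
      \<comment> \<open>Edges of \<open>W\<close> have both ends on the old path, which avoids the
        new vertex. If \<open>e'\<close> were \<open>e\<close>, the end found would be the near one,
        and the new vertex would be \<open>v\<close>.\<close>
      moreover have "e' \<notin> set (walk_edges (W @ [d]))"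
      proof
        assume "e' \<in> set (walk_edges (W @ [d]))"
        moreover have "e' \<notin> set (walk_edges W)"
          using ends_walk_edge[OF W(1), of e'] end' False by auto
        ultimately have "e' = e" using d(3) by simp
        then have "j = i" using e'(2,3) i by auto
        then have "head G d = v" using e'(4) hd e(4) \<open>e' = e\<close> by simp
        then show False using v False by simp
      qed
      moreover note e'(2)
      moreover have "ends G e' ! j = head G d" using e'(4) hd by simp
      ultimately show ?thesis by (rule less.hyps)
    qed
  qed
qed

section \<open>Dependent circuits from positive circles, handcuffs and theta graphs\<close>

lemma positive_cycle_dependent:
  assumes "cycle_walk G u W" "walk_sign G W = 1" "set (walk_edges W) \<subseteq> D"
  shows "has_dependent_circuit G D"
proof -
  note W = cycle_walkD[OF assms(1)]
  obtain d W' where dW: "W = d # W'" using W(2) by (cases W) auto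
  have "positive_circle G (set (walk_edges W))"
    using cycle_walk_circle[OF assms(1)] set_sign_walk[OF W(4)] assms(2) by (simp add: positive_circle_def)
  then have "circuit_walk G (set (walk_edges W)) (None, W, None)"
    using cycle_walk_once_around[OF assms(1)] by (rule circuit_walk.positive_circle)
  moreover have "zvec G (Some (fst d)) \<in> fspace.span (edge_vectors G (D - {fst d}))"
    if "ultrawalk_gain G (None, W, None) = 0"
    using W assms(2,3) that unfolding dW
    by (intro positive_closed_walk_dependency[of u]) auto
  moreover have "fst d \<in> D" using assms(3) dW by simp
  ultimately show ?thesis
    unfolding has_dependent_circuit_def using assms(3) by blast
qed

text \<open>
  A negative figure whose circle comes with a walk once around it; \<open>negative_figure\<close> only says that
  such a circle is connected and 2-regular.
\<close>

definition negative_figure_walk :: "'e set \<Rightarrow> bool" where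
  "negative_figure_walk F \<longleftrightarrow> (\<exists>h. half_edge G h \<and> F = {h}) \<or>
     (\<exists>u W. cycle_walk G u W \<and> walk_sign G W = -1 \<and> F = set (walk_edges W))"

lemma negative_cycle_walk:
  "cycle_walk G u W \<Longrightarrow> walk_sign G W = -1 \<Longrightarrow> negative_circle G (set (walk_edges W))"
  using cycle_walk_circle[of u W] set_sign_walk[of W] cycle_walkD(4)[of G u W]
  by (simp add: negative_circle_def)

lemma negative_figure_walk: "negative_figure_walk F \<Longrightarrow> negative_figure G F"
  using negative_cycle_walk by (auto simp: negative_figure_walk_def negative_figure_def)

lemma negative_figure_once_around_exists:
  assumes "negative_figure_walk F" "x \<in> vset G F" "\<nexists>h. half_edge G h \<and> F = {h}"
  obtains W where "cycle_walk G x W" "walk_sign G W = -1" "F = set (walk_edges W)"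
proof -
  obtain u W where W: "cycle_walk G u W" "walk_sign G W = -1" "F = set (walk_edges W)"
    using assms(1,3) unfolding negative_figure_walk_def by blast
  have "x \<in> head G ` set W" using assms(2) W vset_cycle[OF W(1)] by simp
  then obtain W' where "cycle_walk G x W'" "set (walk_edges W') = set (walk_edges W)"
      "walk_sign G W' = walk_sign G W"
    using cycle_walk_rotate[OF W(1)] by blast
  then show thesis using that W by simp
qed

text \<open>The edge solved for is the half edge in \<open>F\<close>, or the first edge of a walk
  around \<open>F\<close>. It does not recur in the path or in \<open>F'\<close>, which avoid
  \<open>F\<close>. The condition \<open>half\<close> leaves out a circle \<open>F\<close> joined to
  a half edge \<open>F'\<close>, since the circuit walk of a mixed handcuff begins at its half
  edge.\<close>

lemma handcuff_dependent:
  assumes J: "joined_figures G F u P v F'"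
    and F: "negative_figure_walk F" "negative_figure_walk F'"
    and sub: "F \<subseteq> D" "set (walk_edges P) \<subseteq> D - F" "F' \<subseteq> D - F"
    and half: "(\<exists>h. half_edge G h \<and> F' = {h}) \<Longrightarrow> (\<exists>h. half_edge G h \<and> F = {h})"
    and two: "(2 :: 'k) \<noteq> 0"
  shows "has_dependent_circuit G D"
proof -
  have u: "u \<in> vset G F" using J unfolding joined_figures_def by blast
  have "P = [] \<Longrightarrow> u = v" using J by (auto simp: joined_figures_def path_def)
  then have v: "v \<in> vset G F'" using J unfolding joined_figures_def by blast
  note P = joined_figures_walk[OF J]
  consider (hh) h h' where "half_edge G h" "F = {h}" "half_edge G h'" "F' = {h'}"
    | (hc) h where "half_edge G h" "F = {h}" "\<nexists>h. half_edge G h \<and> F' = {h}"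
    | (cc) "\<nexists>h. half_edge G h \<and> F = {h}" "\<nexists>h. half_edge G h \<and> F' = {h}"
    using half by blast
  then show ?thesis
  proof cases
    case hh
    let ?S = "fspace.span (edge_vectors G (D - {h}))"
    note J' = J[unfolded hh(2,4)]
    have "circuit_walk G ({h} \<union> set (walk_edges P) \<union> {h'}) (Some h, P, Some h')"
      using J' hh(1,3) by (rule circuit_walk.half_half)
    moreover have "zvec G (Some h) \<in> ?S" if 0: "ultrawalk_gain G (Some h, P, Some h') = 0"
    proof -
      define \<tau> :: 'k where "\<tau> = of_int (orient G h 0)"
      define \<rho> :: 'k where "\<rho> = of_int (walk_sign G P) * of_int (orient G h' 0)"
      have "zvec G (Some h') \<in> ?S"
        using sub hh by (intro zvec_in_span) auto
      moreover have "walk_vec G u P v \<in> ?S"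
        using sub hh by (intro walk_vec_in_span[OF P]) auto
      ultimately have "fscale \<rho> (zvec G (Some h')) - walk_vec G u P v \<in> ?S"
        by (intro fspace.span_diff fspace.span_scale)
      moreover have "fscale \<rho> (zvec G (Some h')) - walk_vec G u P v = fscale \<tau> (zvec G (Some h))"
        using half_half_walk[OF J' hh(1,3)] unfolding 0
        by (auto simp: fun_eq_iff fscale_apply \<tau>_def \<rho>_def algebra_simps simp del: zvec.simps)
      ultimately have "fscale \<tau> (fscale \<tau> (zvec G (Some h))) \<in> ?S"
        using fspace.span_scale by metis
      moreover have "\<tau> * \<tau> = 1" using half_edge_orient_values[OF hh(1)] by (auto simp: \<tau>_def)
      ultimately show ?thesis by (simp only: fspace.scale_scale fspace.scale_one)
    qed
    moreover have "{h} \<union> set (walk_edges P) \<union> {h'} \<subseteq> D" "h \<in> D" using sub hh by auto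
    ultimately show ?thesis unfolding has_dependent_circuit_def by blast
  next
    case hc
    let ?S = "fspace.span (edge_vectors G (D - {h}))"
    note J' = J[unfolded hc(2)]
    obtain W where W: "cycle_walk G v W" "walk_sign G W = -1" "F' = set (walk_edges W)"
      using negative_figure_once_around_exists[OF F(2) v hc(3)] .
    have O: "once_around G F' v W" using cycle_walk_once_around[OF W(1)] W(3) by simp
    let ?W = "P @ W @ rev_walk P"
    have "circuit_walk G ({h} \<union> set (walk_edges P) \<union> F') (Some h, ?W, Some h)"
      using J' hc(1) O by (rule circuit_walk.half_circle)
    moreover have "zvec G (Some h) \<in> ?S" if 0: "ultrawalk_gain G (Some h, ?W, Some h) = 0"
    proof -
      define \<tau> :: 'k where "\<tau> = of_int (orient G h 0)"
      have "walk_vec G u ?W u \<in> ?S"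
        using sub hc(2) W(3)
        by (intro walk_vec_in_span[OF half_circle_walk(1)[OF J' hc(1) O]]) auto
      then have "- walk_vec G u ?W u \<in> ?S" by (rule fspace.span_neg)
      moreover have "- walk_vec G u ?W u = fscale (2 * \<tau>) (zvec G (Some h))"
        using half_circle_walk(3)[OF J' hc(1) O] unfolding 0
        by (auto simp: fun_eq_iff fscale_apply \<tau>_def eq_neg_iff_add_eq_0 add.commute
            neg_eq_iff_add_eq_0 simp del: zvec.simps)
      \<comment> \<open>The half edge occurs at both ends of the ultrawalk and so has coefficient
        2\<tau>; its inverse is \<tau>/2 because \<tau> squares to 1.\<close>
      ultimately have "fscale (\<tau> / 2) (fscale (2 * \<tau>) (zvec G (Some h))) \<in> ?S"
        using fspace.span_scale by metis
      moreover have "\<tau> / 2 * (2 * \<tau>) = 1"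
        using half_edge_orient_values[OF hc(1)] two by (auto simp: \<tau>_def)
      ultimately show ?thesis by (simp only: fspace.scale_scale fspace.scale_one)
    qed
    moreover have "{h} \<union> set (walk_edges P) \<union> F' \<subseteq> D" "h \<in> D" using sub hc by auto
    ultimately show ?thesis unfolding has_dependent_circuit_def by blast
  next
    case cc
    obtain W where W: "cycle_walk G u W" "walk_sign G W = -1" "F = set (walk_edges W)"
      using negative_figure_once_around_exists[OF F(1) u cc(1)] .
    obtain W' where W': "cycle_walk G v W'" "walk_sign G W' = -1" "F' = set (walk_edges W')"
      using negative_figure_once_around_exists[OF F(2) v cc(2)] .
    have O: "once_around G F u W" "once_around G F' v W'"
      using cycle_walk_once_around[OF W(1)] W(3) cycle_walk_once_around[OF W'(1)] W'(3) by simp_all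
    obtain d W1 where dW: "W = d # W1" using cycle_walkD(2)[OF W(1)] by (cases W) auto
    let ?W = "W @ P @ W' @ rev_walk P"
    have "circuit_walk G (F \<union> set (walk_edges P) \<union> F') (None, ?W, None)"
      using J O by (rule circuit_walk.circle_circle)
    moreover have "zvec G (Some (fst d)) \<in> fspace.span (edge_vectors G (D - {fst d}))"
      if "ultrawalk_gain G (None, ?W, None) = 0"
    proof (rule positive_closed_walk_dependency)
      show "walk G u (d # W1 @ P @ W' @ rev_walk P) u" "walk_sign G (d # W1 @ P @ W' @ rev_walk P) = 1"
        using circle_circle_walk[OF J O] unfolding dW by simp_all
      show "walk_gain G (d # W1 @ P @ W' @ rev_walk P) = 0"
        using that by (simp add: dW)
      show "set (walk_edges (W1 @ P @ W' @ rev_walk P)) \<subseteq> D - {fst d}"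
        using sub cycle_walkD(4)[OF W(1)] W(3) W'(3) by (auto simp: dW)
    qed
    moreover have "F \<union> set (walk_edges P) \<union> F' \<subseteq> D" "fst d \<in> D" using sub W(3) dW by auto
    ultimately show ?thesis unfolding has_dependent_circuit_def by blast
  qed
qed

lemma walk_verts_append_disjoint:
  assumes "walk G x A w" "distinct (walk_verts G x (A @ B))"
  shows "set (walk_verts G x A) \<inter> set (walk_verts G w B) = {w}"
    and "distinct (walk_verts G x A)" "distinct (walk_verts G w B)"
    and "set (walk_verts G x (A @ B)) = set (walk_verts G x A) \<union> set (walk_verts G w B)"
  using assms(2) end_in_walk_verts[OF assms(1)]
  by (auto simp: walk_verts_def)

text \<open>
  The ear \<open>Q\<close> closes up with both arcs of the negative circle \<open>W\<close>; as the arcs have opposite signs, one of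
  the two resulting circles is positive.
\<close>

lemma theta_dependent:
  assumes W: "cycle_walk G u W" "walk_sign G W = -1" "set (walk_edges W) \<subseteq> D"
    and Q: "walk G x Q w" "distinct (walk_verts G x Q)" "x \<noteq> w"
      "set (walk_verts G x Q) \<inter> vset G (set (walk_edges W)) = {x, w}"
      "set (walk_edges Q) \<subseteq> D - set (walk_edges W)"
  shows "has_dependent_circuit G D"
proof -
  let ?F = "set (walk_edges W)"
  have "x \<in> head G ` set W" using Q(4) vset_cycle[OF W(1)] by auto
  then obtain W' where W': "cycle_walk G x W'" "set (walk_edges W') = ?F" "walk_sign G W' = -1"
    using cycle_walk_rotate[OF W(1)] W(2) by metis
  have "w \<in> set (walk_verts G x W')"
    using Q(4) vset_walk[OF cycle_walkD(1,2)[OF W'(1)]] W'(2) by auto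
  then obtain A B where AB: "W' = A @ B" "walk G x A w" "walk G w B x"
    using walk_reaches[OF cycle_walkD(1)[OF W'(1)]] by blast
  have ne: "A \<noteq> []" "B \<noteq> []" using AB(2,3) Q(3) by auto
  \<comment> \<open>Heads along \<open>W'\<close> are distinct, so \<open>x\<close>, a head on
    \<open>B\<close>, is no head on \<open>A\<close>, and \<open>w\<close> is no head on
    \<open>B\<close>. Hence both arcs are paths.\<close>
  have "x \<in> head G ` set B" "w \<in> head G ` set A"
    using end_in_walk_verts[OF AB(3)] end_in_walk_verts[OF AB(2)] Q(3) by (auto simp: set_walk_verts)
  then have dist: "distinct (walk_verts G x A)" "distinct (walk_verts G w B)"
    using cycle_walkD(3)[OF W'(1)] by (auto simp: AB(1) walk_verts_def)
  have sub: "set (walk_verts G x A) \<subseteq> vset G ?F" "set (walk_verts G w B) \<subseteq> vset G ?F"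
    using vset_walk[OF cycle_walkD(1,2)[OF W'(1)]] end_in_walk_verts[OF AB(2)] unfolding W'(2)
    by (auto simp: AB(1) set_walk_verts)
  have esub: "set (walk_edges A) \<subseteq> ?F" "set (walk_edges B) \<subseteq> ?F"
    using W'(2) by (auto simp: AB(1))
  have "cycle_walk G x (Q @ B)"
  proof (rule path_join[OF Q(1,2) AB(3) dist(2) Q(3)])
    show "set (walk_verts G x Q) \<inter> set (walk_verts G w B) \<subseteq> {x, w}" using Q(4) sub(2) by blast
    show "set (walk_edges Q) \<inter> set (walk_edges B) = {}" using Q(5) esub(2) by blast
  qed
  moreover have "cycle_walk G x (Q @ rev_walk A)"
  proof (rule path_join[OF Q(1,2) walk_rev_walk[OF AB(2)] _ Q(3)])
    note rv = walk_verts_rev_walk[OF AB(2)]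
    show "distinct (walk_verts G w (rev_walk A))" using dist(1) rv by simp
    have "set (walk_verts G w (rev_walk A)) = set (walk_verts G x A)" using rv by simp
    then show "set (walk_verts G x Q) \<inter> set (walk_verts G w (rev_walk A)) \<subseteq> {x, w}"
      using Q(4) sub(1) by blast
    show "set (walk_edges Q) \<inter> set (walk_edges (rev_walk A)) = {}"
      using Q(5) esub(1) unfolding set_walk_edges_rev_walk by blast
  qed
  \<comment> \<open>The product of the two signs is the sign of the whole circle, -1, since the sign
    of \<open>Q\<close> enters twice.\<close>
  moreover have "walk_sign G (Q @ B) = 1 \<or> walk_sign G (Q @ rev_walk A) = 1"
    using walk_sign_values[OF Q(1)] walk_sign_values[OF AB(2)] walk_sign_values[OF AB(3)] W'(3)
    by (auto simp: AB(1))
  moreover have "set (walk_edges (Q @ B)) \<subseteq> D" "set (walk_edges (Q @ rev_walk A)) \<subseteq> D"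
    using Q(5) esub W(3) by auto
  ultimately show ?thesis
    using positive_cycle_dependent by blast
qed

text \<open>A path grown from \<open>F\<close> through \<open>e\<close> must stop. At a half edge it
  gives a handcuff; at one of its own vertices it closes a circle, which is positive or forms a
  handcuff with \<open>F\<close>; at another vertex of \<open>F\<close> it is an ear and gives a
  theta graph. The condition \<open>half\<close> makes \<open>F\<close> a half edge in the first
  case.\<close>

lemma negative_figure_attached_dependent:
  assumes D: "D \<subseteq> edges G" "leafless G D"
    and F: "negative_figure_walk F" "F \<subseteq> D"
    and half: "(\<exists>h\<in>D. half_edge G h) \<Longrightarrow> \<exists>h. half_edge G h \<and> F = {h}"
    and e: "e \<in> D - F" "i < length (ends G e)" "ends G e ! i \<in> vset G F"
    and two: "(2 :: 'k) \<noteq> 0"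
  shows "has_dependent_circuit G D"
proof -
  let ?X = "vset G F"
  define x where "x = ends G e ! i"
  have "set (ends G e) \<subseteq> verts G" using ends_verts D(1) e(1) by blast
  then have x: "x \<in> ?X" "x \<in> verts G"
    using e(3) nth_mem[OF e(2)] unfolding x_def by blast+
  have F0: "\<forall>e\<in>F. set (ends G e) \<subseteq> ?X" by (auto simp: vset_def)
  have W0: "walk G x [] x" "distinct (walk_verts G x [])" "set (walk_verts G x []) \<inter> ?X = {x}"
    "set (walk_edges []) \<subseteq> D - F" "e \<notin> set (walk_edges [])"
    using x by auto
  obtain W v where W: "walk G x W v" "distinct (walk_verts G x W)" "set (walk_verts G x W) \<inter> ?X = {x}"
      "set (walk_edges W) \<subseteq> D - F"
    and closing: "(\<exists>h\<in>D - F. half_edge G h \<and> hd (ends G h) = v)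
      \<or> (\<exists>d. is_step G d \<and> fst d \<in> D - F - set (walk_edges W) \<and> tail G d = v
           \<and> head G d \<in> ?X \<union> set (walk_verts G x W))"
    using extend_path[OF D F0 W0(1-4) e(1) W0(5) e(2) x_def[symmetric]]
    by (elim exE conjE) (rule that; assumption)
  \<comment> \<open>A return to \<open>x\<close> lies in both closing sets and is counted as
    \<open>lollipop\<close>, so an \<open>ear\<close> has two different ends.\<close>
  from closing consider (h) h where "h \<in> D - F" "half_edge G h" "hd (ends G h) = v"
    | (lollipop) d where "is_step G d" "fst d \<in> D - F - set (walk_edges W)" "tail G d = v"
       "head G d \<in> set (walk_verts G x W)"
    | (ear) d where "is_step G d" "fst d \<in> D - F - set (walk_edges W)" "tail G d = v"
       "head G d \<in> ?X" "head G d \<notin> set (walk_verts G x W)"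
    by blast
  then show ?thesis
  proof cases
    case h
    have Fh: "negative_figure_walk {h}" using h(2) by (auto simp: negative_figure_walk_def)
    have v: "v \<in> set (walk_verts G x W)" using W(1) by (rule end_in_walk_verts)
    have "W = [] \<or> v \<noteq> x"
      using W(1,2) by (cases W rule: rev_cases) (auto simp: walk_snoc walk_verts_def)
    then have "W = [] \<and> ?X \<inter> {v} = {x} \<or> ?X \<inter> {v} = {} \<and> set (walk_verts G x W) \<inter> ?X = {x}
        \<and> set (walk_verts G x W) \<inter> {v} = {v}"
    proof
      assume "W = []"
      moreover have "v = x" using W(1) calculation by simp
      ultimately show ?thesis using x(1) by blast
    next
      assume "v \<noteq> x"
      then have "?X \<inter> {v} = {}" using v W(3) by blast
      then show ?thesis using v W(3) by blast
    qed
    then have "joined_figures G F x W v {h}"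
      unfolding joined_figures_def vset_half_edge[OF h(2)] h(3) path_def
      using negative_figure_walk[OF F(1)] negative_figure_walk[OF Fh] h(1) W(1,2) by blast
    then show ?thesis
      using handcuff_dependent[OF _ F(1) Fh F(2) W(4)] h half two by blast
  next
    case (lollipop d)
    define w where "w = head G d"
    obtain A B where AB: "W = A @ B" "walk G x A w" "walk G w B v"
      using walk_reaches[OF W(1) lollipop(4)] unfolding w_def .
    note AB' = walk_verts_append_disjoint[OF AB(2) W(2)[unfolded AB(1)]]
    let ?c = "B @ [d]"
    have c: "cycle_walk G w ?c"
    proof (rule path_close[OF AB(3) AB'(3) lollipop(1,3) w_def[symmetric]])
      show "fst d \<notin> set (walk_edges B)" using lollipop(2) AB(1) by simp
    qed
    have cD: "set (walk_edges ?c) \<subseteq> D - F"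
      using lollipop(2) W(4) AB(1) by auto
    have vc: "vset G (set (walk_edges ?c)) = set (walk_verts G w B)"
      unfolding vset_walk[OF cycle_walkD(1,2)[OF c]] by (auto simp: w_def set_walk_verts)
    show ?thesis
    proof (cases "walk_sign G ?c = 1")
      case True
      then show ?thesis using positive_cycle_dependent[OF c] cD by blast
    next
      case False
      then have neg: "walk_sign G ?c = -1" using walk_sign_values[OF cycle_walkD(1)[OF c]] by blast
      let ?F' = "set (walk_edges ?c)"
      have F': "negative_figure_walk ?F'" using c neg unfolding negative_figure_walk_def by blast
      \<comment> \<open>If the stick \<open>A\<close> is nonempty, \<open>x\<close> is visited
        before the circle begins and not again, so the circle avoids \<open>F\<close>.\<close>
      have "x \<notin> set (walk_verts G w B)" if "A \<noteq> []"
      proof -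
        obtain A' a where "A = A' @ [a]" using \<open>A \<noteq> []\<close> rev_exhaust by blast
        then have "w \<in> head G ` set A"
          using AB(2) by (simp add: walk_snoc)
        moreover have "x \<notin> head G ` set (A @ B)" using W(2) AB(1) by (simp add: walk_verts_def image_Un)
        ultimately show ?thesis by (auto simp: set_walk_verts)
      qed
      then have "A = [] \<or> x \<notin> set (walk_verts G w B)" by blast
      then have "A = [] \<and> ?X \<inter> set (walk_verts G w B) = {x} \<or> ?X \<inter> set (walk_verts G w B) = {} \<and>
          set (walk_verts G x A) \<inter> ?X = {x} \<and> set (walk_verts G x A) \<inter> set (walk_verts G w B) = {w}"
      proof
        assume "A = []"
        have "W = B" using AB(1) \<open>A = []\<close> by simp
        moreover have "w = x" using AB(2) \<open>A = []\<close> by simp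
        ultimately have "?X \<inter> set (walk_verts G w B) = {x}" using W(3) by (metis Int_commute)
        then show ?thesis using \<open>A = []\<close> by blast
      next
        assume *: "x \<notin> set (walk_verts G w B)"
        have "x \<in> set (walk_verts G x A)" by (simp add: set_walk_verts)
        moreover have "(set (walk_verts G x A) \<union> set (walk_verts G w B)) \<inter> ?X = {x}"
          using W(3) AB'(4) AB(1) by simp
        ultimately have "set (walk_verts G x A) \<inter> ?X = {x}" "?X \<inter> set (walk_verts G w B) = {}"
          using * x(1) by auto
        then show ?thesis using AB'(1) by simp
      qed
      note disj = this
      have "fst d \<in> ?F'" "fst d \<notin> F" using lollipop(2) by simp_all
      then have "F \<noteq> ?F'" by blast
      then have J: "joined_figures G F x A w ?F'"
        unfolding joined_figures_def vc path_def
        by (intro conjI negative_figure_walk[OF F(1)] negative_figure_walk[OF F'] AB(2) AB'(2) disj)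
      have no_half: "\<nexists>h. half_edge G h \<and> ?F' = {h}"
        using walk_edge_link_or_loop[OF cycle_walkD(1)[OF c]] half_edge_not_link_or_loop
        by (metis singletonI)
      have "set (walk_edges A) \<subseteq> D - F" using W(4) AB(1) by auto
      then show ?thesis
        by (rule handcuff_dependent[OF J F(1) F' F(2) _ cD _ two]) (use no_half in blast)
    qed
  next
    case (ear d)
    have neq: "head G d \<noteq> x" using ear(5) by (auto simp: set_walk_verts)
    \<comment> \<open>The ear ends at a vertex of \<open>F\<close> different from \<open>x\<close>,
      whereas a half edge has only one vertex.\<close>
    have "\<nexists>h. half_edge G h \<and> F = {h}"
      using x(1) ear(4) neq vset_half_edge by (metis singletonD)
    then obtain u c where c: "cycle_walk G u c" "walk_sign G c = -1" "F = set (walk_edges c)"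
      using F(1) unfolding negative_figure_walk_def by blast
    show ?thesis
    proof (rule theta_dependent[OF c(1,2)])
      show "set (walk_edges c) \<subseteq> D" using F(2) c(3) by simp
      show "walk G x (W @ [d]) (head G d)" using W(1) ear by (simp add: walk_snoc)
      show "distinct (walk_verts G x (W @ [d]))" using W(2) ear(5) by simp
      show "x \<noteq> head G d" using neq by simp
      show "set (walk_verts G x (W @ [d])) \<inter> vset G (set (walk_edges c)) = {x, head G d}"
        using W(3) ear(4) c(3) by auto
      show "set (walk_edges (W @ [d])) \<subseteq> D - set (walk_edges c)"
        using W(4) ear(2) c(3) by auto
    qed
  qed
qed

text \<open>The value 1 is propagated from \<open>u\<close> by the edge signs. Since the vertices
  are distinct, setting the value at a new vertex does not disturb earlier edges. Being 0 elsewhere,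
  the functional ignores edges that do not touch the path.\<close>

lemma path_potential:
  assumes "walk G u W v" "distinct (walk_verts G u W)"
  shows "\<exists>\<eta>. \<eta> u = (1 :: 'k) \<and> \<eta> v = of_int (walk_sign G W) \<and>
    (\<forall>e\<in>set (walk_edges W). end_sum G \<eta> e = 0) \<and> (\<forall>x. x \<notin> set (walk_verts G u W) \<longrightarrow> \<eta> x = 0)"
  using assms
proof (induction W arbitrary: v rule: rev_induct)
  case Nil
  then show ?case by (intro exI[of _ "\<lambda>x. if x = u then 1 else 0"]) auto
next
  case (snoc d W)
  have d: "walk G u W (tail G d)" "is_step G d" "head G d = v" using snoc.prems by (auto simp: walk_snoc)
  have dist: "distinct (walk_verts G u W)" and hd: "v \<notin> set (walk_verts G u W)"
    using snoc.prems(2) d(3) by (auto simp: walk_verts_def)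
  obtain \<eta> :: "'v \<Rightarrow> 'k" where \<eta>: "\<eta> u = 1" "\<eta> (tail G d) = of_int (walk_sign G W)"
    "\<And>e. e \<in> set (walk_edges W) \<Longrightarrow> end_sum G \<eta> e = 0" "\<And>x. x \<notin> set (walk_verts G u W) \<Longrightarrow> \<eta> x = 0"
    using snoc.IH[OF d(1) dist] by blast
  define \<theta> where "\<theta> = (\<lambda>x. if x = v then of_int (walk_sign G (W @ [d])) else \<eta> x)"
  have "u \<noteq> v" using hd by (auto simp: set_walk_verts)
  moreover have "tail G d \<noteq> v" using hd end_in_walk_verts[OF d(1)] by auto
  moreover have "end_sum G \<theta> e = 0" if "e \<in> set (walk_edges W)" for e
  proof -
    have "v \<notin> set (ends G e)" using ends_walk_edge[OF d(1) that] hd by blast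
    then have "end_sum G \<theta> e = end_sum G \<eta> e" by (intro end_sum_cong) (auto simp: \<theta>_def)
    then show ?thesis using \<eta>(3) that by simp
  qed
  moreover have "end_sum G \<theta> (fst d) = 0"
  proof -
    have "(of_int (esign G (fst d)) :: 'k) * of_int (esign G (fst d)) = 1"
      using esign_square[OF step_edges[OF d(2)]] by (metis of_int_1 of_int_mult)
    then show ?thesis
      using end_sum_step[OF d(2), of \<theta>] \<eta>(2) \<open>tail G d \<noteq> v\<close> d(3)
      by (simp add: \<theta>_def mult.left_commute)
  qed
  ultimately show ?case
    using \<eta> d(3) by (intro exI[of _ \<theta>]) (auto simp: \<theta>_def)
qed

text \<open>The relation is tested with the potential of the circle minus its closing edge. All
  other edges of \<open>D\<close> evaluate to 0, while the closing edge picks up the defect of a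
  negative circle, 2 or -2; its coefficient would have to vanish.\<close>

lemma negative_cycle_isolated_contradiction:
  assumes D: "D \<subseteq> edges G" "finite D"
    and c: "\<And>e. e \<in> D \<Longrightarrow> c e \<noteq> (0 :: 'k)" "\<And>\<eta>. (\<Sum>e\<in>D. c e * end_sum G \<eta> e) = 0"
    and W: "cycle_walk G u W" "walk_sign G W = -1" "set (walk_edges W) \<subseteq> D"
    and iso: "\<And>e. e \<in> D - set (walk_edges W) \<Longrightarrow> set (ends G e) \<inter> vset G (set (walk_edges W)) = {}"
    and two: "(2 :: 'k) \<noteq> 0"
  shows False
proof -
  note W' = cycle_walkD[OF W(1)]
  obtain P d where P: "W = P @ [d]" using W'(2) by (cases W rule: rev_cases) auto
  have d: "walk G u P (tail G d)" "is_step G d" "head G d = u"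
    using W'(1) by (auto simp: P walk_snoc)
  have "distinct (walk_verts G u P)" using W'(3) d(3) by (auto simp: P walk_verts_def)
  from path_potential[OF d(1) this] obtain \<eta> :: "'v \<Rightarrow> 'k"
    where \<eta>: "\<eta> u = 1" "\<eta> (tail G d) = of_int (walk_sign G P)"
      "\<And>e. e \<in> set (walk_edges P) \<Longrightarrow> end_sum G \<eta> e = 0"
      "\<And>x. x \<notin> set (walk_verts G u P) \<Longrightarrow> \<eta> x = 0"
    by blast
  have vs: "set (walk_verts G u P) \<subseteq> vset G (set (walk_edges W))"
    using vset_walk[OF W'(1,2)] by (auto simp: P set_walk_verts)
  have dD: "fst d \<in> D" using W(3) by (simp add: P)
  have "end_sum G \<eta> e = 0" if "e \<in> D - {fst d}" for e
  proof (cases "e \<in> set (walk_edges W)")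
    case True
    then show ?thesis using \<eta>(3) that by (auto simp: P)
  next
    case False
    then show ?thesis using iso[of e] that vs \<eta>(4) by (intro end_sum_eq_0) blast
  qed
  then have "(\<Sum>e\<in>D. c e * end_sum G \<eta> e) = c (fst d) * end_sum G \<eta> (fst d)"
    using dD D(2) by (simp add: sum.remove[of D "fst d"])
  then have 0: "end_sum G \<eta> (fst d) = 0" using c dD by simp
  \<comment> \<open>The path and the closing edge have signs with product -1, so the two terms at
    the closing edge add up instead of cancelling.\<close>
  have "of_int (walk_sign G P) = - (of_int (esign G (fst d)) :: 'k)"
    using W(2) esign_values[OF step_edges[OF d(2)]] walk_sign_values[OF d(1)] by (auto simp: P)
  then have "end_sum G \<eta> (fst d) = of_int (orient G (fst d) (snd d)) * (- 2 * of_int (esign G (fst d)))"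
    unfolding end_sum_step[OF d(2)] \<eta>(2) d(3) \<eta>(1) by simp
  with 0 two show False
    using step_orient_values[OF d(2)] esign_values[OF step_edges[OF d(2)]] by auto
qed

text \<open>In the coordinate of a vertex met by a single end, the relation has a single term, a
  nonzero coefficient times an end sign.\<close>

lemma leafless_if_dependent:
  assumes D: "D \<subseteq> edges G" "finite D"
    and c: "\<And>e. e \<in> D \<Longrightarrow> c e \<noteq> (0 :: 'k)" "\<And>\<eta>. (\<Sum>e\<in>D. c e * end_sum G \<eta> e) = 0"
  shows "leafless G D"
  unfolding leafless_def
proof (intro ballI allI impI, rule ccontr)
  fix e i
  assume e: "e \<in> D" "i < length (ends G e)"
    and "\<not> (\<exists>e'\<in>D. \<exists>j<length (ends G e'). (e', j) \<noteq> (e, i) \<and> ends G e' ! j = ends G e ! i)"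
  then have leaf: "e' = e \<and> j = i" if "e' \<in> D" "j < length (ends G e')" "ends G e' ! j = ends G e ! i" for e' j
    using that by blast
  let ?\<eta> = "\<lambda>w. if w = ends G e ! i then 1 else 0 :: 'k"
  have "end_sum G ?\<eta> e' = 0" if "e' \<in> D - {e}" for e'
    using leaf that by (intro end_sum_eq_0) (auto simp: in_set_conv_nth)
  then have "(\<Sum>e\<in>D. c e * end_sum G ?\<eta> e) = c e * end_sum G ?\<eta> e"
    using e D(2) by (simp add: sum.remove[of D e])
  moreover have "end_sum G ?\<eta> e = (\<Sum>j<length (ends G e). if j = i then of_int (orient G e i) else 0)"
    unfolding end_sum_def using leaf[OF e(1)] by (intro sum.cong) auto
  then have "end_sum G ?\<eta> e = of_int (orient G e i)" using e(2) by simp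
  ultimately show False using c(1)[OF e(1)] c(2)[of ?\<eta>] orient_nonzero[of e i] e D(1) by auto
qed

text \<open>A half edge in \<open>D\<close> has another edge at its vertex and serves as the first
  figure. Otherwise a growing path closes a circle. If it is positive, it suffices; if negative, any
  edge of \<open>D\<close> touching it leads to a circuit, and with no such edge the relation itself
  is contradicted.\<close>

lemma dependent_circuit_exists:
  assumes D: "D \<subseteq> edges G" "finite D" "D \<noteq> {}" "\<And>e. e \<in> D \<Longrightarrow> \<not> loose_edge G e"
    and c: "\<And>e. e \<in> D \<Longrightarrow> c e \<noteq> (0 :: 'k)" "\<And>\<eta>. (\<Sum>e\<in>D. c e * end_sum G \<eta> e) = 0"
    and two: "(2 :: 'k) \<noteq> 0"
  shows "has_dependent_circuit G D"
proof (rule ccontr)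
  assume not: "\<not> has_dependent_circuit G D"
  have L: "leafless G D" using leafless_if_dependent[OF D(1,2) c] .
  have attached: False
    if "negative_figure_walk F" "F \<subseteq> D" "(\<exists>h\<in>D. half_edge G h) \<Longrightarrow> \<exists>h. half_edge G h \<and> F = {h}"
      "e \<in> D - F" "i < length (ends G e)" "ends G e ! i \<in> vset G F" for F e i
    using negative_figure_attached_dependent[OF D(1) L that(1-3) that(4-6) two] not by blast
  show False
  proof (cases "\<exists>h\<in>D. half_edge G h")
    case True
    then obtain h where h: "h \<in> D" "half_edge G h" by blast
    then have len: "0 < length (ends G h)" by (simp add: half_edge_def)
    then obtain e j where e: "e \<in> D" "j < length (ends G e)" "(e, j) \<noteq> (h, 0)" "ends G e ! j = ends G h ! 0"
      using L h(1) unfolding leafless_def by blast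
    have "e \<noteq> h" using e(2,3) h(2) by (auto simp: half_edge_def)
    moreover have "ends G e ! j \<in> vset G {h}" using e(4) nth_mem[OF len] by (simp add: vset_def)
    ultimately show False
      using attached[of "{h}" e j] h e(1,2) by (auto simp: negative_figure_walk_def)
  next
    case False
    obtain e where e: "e \<in> D" using D(3) by blast
    define x where "x = ends G e ! 0"
    have len: "0 < length (ends G e)" using D(1,4) e by (auto simp: loose_edge_def)
    have "set (ends G e) \<subseteq> verts G" using ends_verts D(1) e by blast
    then have x: "x \<in> verts G" using nth_mem[OF len] unfolding x_def by blast
    have W0: "walk G x [] x" "distinct (walk_verts G x [])" "set (walk_verts G x []) \<inter> {x} = {x}"
      "set (walk_edges []) \<subseteq> D - {}" "e \<in> D - {}" "e \<notin> set (walk_edges [])"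
      using x e by auto
    \<comment> \<open>With \<open>F\<close> empty and \<open>X\<close> the start vertex, and no half
      edges in \<open>D\<close>, the path can stop only at one of its own vertices.\<close>
    have F0: "\<forall>e\<in>{}. set (ends G e) \<subseteq> {x}" by simp
    obtain W v where W: "walk G x W v" "distinct (walk_verts G x W)" "set (walk_edges W) \<subseteq> D - {}"
      and closing: "(\<exists>h\<in>D - {}. half_edge G h \<and> hd (ends G h) = v)
        \<or> (\<exists>d. is_step G d \<and> fst d \<in> D - {} - set (walk_edges W) \<and> tail G d = v
           \<and> head G d \<in> {x} \<union> set (walk_verts G x W))"
      using extend_path[OF D(1) L F0 W0 len x_def[symmetric]]
      by (elim exE conjE) (auto intro: that)
    have "x \<in> set (walk_verts G x W)" by (simp add: set_walk_verts)
    then obtain d where d: "is_step G d" "fst d \<in> D - set (walk_edges W)" "tail G d = v"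
         "head G d \<in> set (walk_verts G x W)"
      using closing False by auto
    obtain A B where AB: "W = A @ B" "walk G x A (head G d)" "walk G (head G d) B v"
      using walk_reaches[OF W(1) d(4)] by blast
    let ?C = "B @ [d]"
    have C: "cycle_walk G (head G d) ?C"
      using d AB walk_verts_append_disjoint(3)[OF AB(2) W(2)[unfolded AB(1)]]
      by (intro path_close) auto
    have CD: "set (walk_edges ?C) \<subseteq> D" using W(3) d(2) AB(1) by auto
    then have neg: "walk_sign G ?C = -1"
      using positive_cycle_dependent[OF C] not walk_sign_values[OF cycle_walkD(1)[OF C]] by blast
    then have "negative_figure_walk (set (walk_edges ?C))"
      using C unfolding negative_figure_walk_def by blast
    then have "set (ends G e) \<inter> vset G (set (walk_edges ?C)) = {}" if "e \<in> D - set (walk_edges ?C)" for e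
      using attached[OF _ CD _ that] False by (auto simp: in_set_conv_nth)
    then show False
      using negative_cycle_isolated_contradiction[OF D(1,2) c C neg CD _ two] by blast
  qed
qed

end

section \<open>Hyperbalance and the extra element\<close>

text \<open>Coefficients are attached to edges and not to vectors, because parallel edges may have
  the same vector.\<close>

lemma span_image_sum:
  assumes "finite D" "x \<in> fspace.span (z ` D)"
  shows "\<exists>c. x = (\<Sum>e\<in>D. fscale (c e) (z e))"
  using assms
proof (induction D arbitrary: x rule: finite_induct)
  case empty
  then show ?case by simp
next
  case (insert a D)
  then obtain k where "x - fscale k (z a) \<in> fspace.span (z ` D)"
    using fspace.span_breakdown_eq by (metis image_insert)
  then obtain c where c: "x - fscale k (z a) = (\<Sum>e\<in>D. fscale (c e) (z e))"
    using insert.IH by blast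
  have "(\<Sum>e\<in>insert a D. fscale ((c(a := k)) e) (z e)) = fscale k (z a) + (\<Sum>e\<in>D. fscale ((c(a := k)) e) (z e))"
    using insert.hyps by simp
  also have "(\<Sum>e\<in>D. fscale ((c(a := k)) e) (z e)) = (\<Sum>e\<in>D. fscale (c e) (z e))"
    using insert.hyps by (intro sum.cong) auto
  also have "fscale k (z a) + \<dots> = x"
    unfolding c[symmetric] by (metis add.commute diff_add_cancel)
  finally show ?case by metis
qed

lemma sum_in_span:
  "(\<Sum>e\<in>D. fscale (c e) (zvec G (Some e))) \<in> fspace.span (edge_vectors G D)"
  by (intro fspace.span_sum fspace.span_scale zvec_in_span)

context gain_signed_graph
begin

lemma circuit_walk_sign_circuit:
  assumes "circuit_walk G C W"
  shows "sign_circuit G C"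
  using assms
proof cases
  case (half_circle h u\<^sub>1 P u\<^sub>2 C\<^sub>2 W\<^sub>2)
  then show ?thesis unfolding sign_circuit_def handcuff_def by blast
qed (unfold sign_circuit_def handcuff_def, blast+)

lemma hyperbalanced_gain:
  assumes "hyperbalanced G S" "sign_circuit G C" "C \<subseteq> S" "circuit_gain G C g"
  shows "g = 0"
  using assms by (auto simp: hyperbalanced_def neutral_circuit_def)

text \<open>This exhibits \<open>end_sum\<close> as a linear functional of the vertex coordinates,
  so a relation between vectors can be tested with any \<eta>.\<close>

lemma end_sum_coordinates:
  assumes "e \<in> edges G"
  shows "end_sum G \<eta> e = (\<Sum>v\<in>verts G. \<eta> v * zvec G (Some e) (Some v))"
proof -
  have "(\<Sum>v\<in>verts G. \<eta> v * zvec G (Some e) (Some v))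
    = (\<Sum>v\<in>verts G. \<Sum>i<length (ends G e). of_int (orient G e i) * (if ends G e ! i = v then \<eta> v else 0))"
    unfolding zvec_Some end_sum_def sum_distrib_left by (intro sum.cong) auto
  also have "\<dots> = (\<Sum>i<length (ends G e). of_int (orient G e i) * (\<Sum>v\<in>verts G. if ends G e ! i = v then \<eta> v else 0))"
    by (subst sum.swap) (simp add: sum_distrib_left)
  also have "\<dots> = end_sum G \<eta> e"
    unfolding end_sum_def
    using ends_verts[OF assms] finite_verts by (intro sum.cong) (auto simp: nth_mem subset_eq)
  finally show ?thesis by simp
qed

lemma edge_vectors_redundant:
  assumes "zvec G (Some f) \<in> fspace.span (edge_vectors G (D - {f}))" "f \<in> D"
  shows "fspace.span (edge_vectors G D) = fspace.span (edge_vectors G (D - {f}))"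
proof -
  have "edge_vectors G D = insert (zvec G (Some f)) (edge_vectors G (D - {f}))"
    using assms(2) unfolding edge_vectors_def by blast
  then show ?thesis using fspace.span_redundant[OF assms(1)] by simp
qed

lemma basis_vec_nonzero: "basis_vec i \<noteq> (0 :: 'i \<Rightarrow> 'k)"
  by (metis basis_vec_def zero_fun_apply zero_neq_one)

lemma hyperbalanced_not_in_span:
  assumes S: "S \<subseteq> edges G" "hyperbalanced G S" and two: "(2 :: 'k) \<noteq> 0"
  shows "basis_vec None \<notin> fspace.span (edge_vectors G S)"
proof
  assume "basis_vec None \<in> fspace.span (edge_vectors G S)"
  then obtain D where D: "D \<subseteq> S" "basis_vec None \<in> fspace.span (edge_vectors G D)"
    and least: "\<And>D'. D' \<subseteq> S \<Longrightarrow> basis_vec None \<in> fspace.span (edge_vectors G D') \<Longrightarrow> card D \<le> card D'"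
    using ex_has_least_nat[of "\<lambda>D. D \<subseteq> S \<and> basis_vec None \<in> fspace.span (edge_vectors G D)" S card]
    by blast
  have DE: "D \<subseteq> edges G" and finD: "finite D"
    using D(1) S(1) finite_edges by (auto intro: finite_subset)
  have minimal: "basis_vec None \<notin> fspace.span (edge_vectors G (D - {f}))" if "f \<in> D" for f
    using least[of "D - {f}"] that D(1) finD by (meson card_Diff1_less leD subset_trans Diff_subset)
  \<comment> \<open>An edge expressed by the others could be dropped without changing the span,
    giving a smaller set that still spans e_0.\<close>
  have irredundant: "zvec G (Some f) \<notin> fspace.span (edge_vectors G (D - {f}))" if "f \<in> D" for f
    using minimal[OF that] D(2) edge_vectors_redundant[OF _ that] by blast
  obtain c where c: "basis_vec None = (\<Sum>e\<in>D. fscale (c e) (zvec G (Some e)))"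
    using span_image_sum[OF finD] D(2) unfolding edge_vectors_def by blast
  have c0: "c e \<noteq> 0" if "e \<in> D" for e
  proof
    assume "c e = 0"
    then have "fscale (c e) (zvec G (Some e)) = 0" by (simp only: fspace.scale_zero_left)
    then have "basis_vec None = (\<Sum>e\<in>D - {e}. fscale (c e) (zvec G (Some e)))"
      unfolding c using that finD by (subst sum.remove[of D e]) (simp_all del: zvec.simps)
    then show False using minimal[OF that] sum_in_span[of c G "D - {e}"] by argo
  qed
  have rel: "(\<Sum>e\<in>D. c e * end_sum G \<eta> e) = 0" for \<eta>
  proof -
    have coord: "(\<Sum>e\<in>D. c e * zvec G (Some e) (Some v)) = 0" for v
      using fun_cong[OF c, of "Some v"]
      by (simp add: sum_apply fscale_apply basis_vec_def del: zvec.simps)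
    have "(\<Sum>e\<in>D. c e * end_sum G \<eta> e) = (\<Sum>e\<in>D. \<Sum>v\<in>verts G. \<eta> v * (c e * zvec G (Some e) (Some v)))"
      using DE by (intro sum.cong) (auto simp: end_sum_coordinates sum_distrib_left mult.left_commute simp del: zvec.simps)
    also have "\<dots> = (\<Sum>v\<in>verts G. \<eta> v * (\<Sum>e\<in>D. c e * zvec G (Some e) (Some v)))"
      by (subst sum.swap) (simp add: sum_distrib_left del: zvec.simps)
    finally show ?thesis unfolding coord by simp
  qed
  have "D \<noteq> {}"
  proof
    assume "D = {}"
    then have "basis_vec None \<in> {0 :: 'v option \<Rightarrow> 'k}"
      using D(2) by (simp only: edge_vectors_def image_empty fspace.span_empty)
    then show False using basis_vec_nonzero by (metis singletonD)
  qed
  moreover have "\<not> loose_edge G e" if "e \<in> D" for e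
  proof
    assume e: "loose_edge G e"
    then have "sign_circuit G {e}" by (auto simp: sign_circuit_def)
    then have "gain G e = 0"
      using hyperbalanced_gain[OF S(2) _ _ circuit_gain.loose[OF e]] that D(1) by blast
    then have "zvec G (Some e) = 0"
      unfolding zvec_loose_edge[OF e] by (simp only: fspace.scale_zero_left)
    then show False using irredundant[OF that] fspace.span_zero by metis
  qed
  ultimately have "has_dependent_circuit G D"
    using dependent_circuit_exists[OF DE finD _ _ c0 rel two] by blast
  then obtain C W f where C: "circuit_walk G C W" "C \<subseteq> D" "f \<in> D"
    "ultrawalk_gain G W = 0 \<Longrightarrow> zvec G (Some f) \<in> fspace.span (edge_vectors G (D - {f}))"
    unfolding has_dependent_circuit_def by blast
  have "ultrawalk_gain G W = 0"
    using hyperbalanced_gain[OF S(2) circuit_walk_sign_circuit[OF C(1)] _ circuit_gain.walk[OF C(1)]] C(2) D(1)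
    by blast
  then show False using C(4) irredundant[OF C(3)] by blast
qed

lemma hyperfrustrated_in_span:
  assumes "\<not> hyperbalanced G S"
  shows "basis_vec None \<in> fspace.span (edge_vectors G S)"
proof -
  obtain C g where C: "C \<subseteq> S" "circuit_gain G C g" "g \<noteq> 0"
    using assms unfolding hyperbalanced_def neutral_circuit_def by blast
  have "fscale g (basis_vec None) \<in> fspace.span (edge_vectors G S)"
    using circuit_gain_in_span[OF C(2)] fspace.span_mono[OF edge_vectors_mono[OF C(1)]] by blast
  then have "fscale (inverse g) (fscale g (basis_vec None)) \<in> fspace.span (edge_vectors G S)"
    by (rule fspace.span_scale)
  then show ?thesis by (simp only: fspace.scale_scale left_inverse[OF C(3)] fspace.scale_one)
qed

section \<open>Balanced components\<close>

lemma walk_if_connected: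
  assumes "(u, v) \<in> connected_in G S"
  obtains W where "walk G u W v" "set (walk_edges W) \<subseteq> S"
proof -
  have "(u, v) \<in> (adjacency G S)\<^sup>*" "u \<in> verts G" using assms by (auto simp: connected_in_def)
  then have "\<exists>W. walk G u W v \<and> set (walk_edges W) \<subseteq> S"
  proof (induction rule: rtrancl_induct)
    case base
    then show ?case by (intro exI[of _ "[]"]) simp
  next
    case (step v w)
    then obtain W where W: "walk G u W v" "set (walk_edges W) \<subseteq> S" by blast
    from step(2) obtain e where e: "e \<in> S" "link_or_loop G e" "set (ends G e) = {v, w}"
      unfolding adjacency_def by blast
    have st: "is_step G (e, 0)" using e(2) by (simp add: is_step_def)
    then have "{tail G (e, 0), head G (e, 0)} = {v, w}"
      using set_ends_step[OF st] e(3) by simp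
    then have "tail G (e, 0) = v \<and> head G (e, 0) = w \<or> tail G (e, 0) = w \<and> head G (e, 0) = v"
      by (auto simp: doubleton_eq_iff)
    then obtain d where "is_step G d" "fst d = e" "tail G d = v" "head G d = w"
      using st is_step_rev[OF st] head_rev[OF st] tail_rev[of "(e, 0)"] by (metis fst_conv fst_rev_step)
    then have "walk G u (W @ [d]) w \<and> set (walk_edges (W @ [d])) \<subseteq> S"
      using W e(1) by (simp add: walk_snoc)
    then show ?case by blast
  qed
  then show thesis using that by blast
qed

lemma step_connected: "is_step G d \<Longrightarrow> fst d \<in> S \<Longrightarrow> (tail G d, head G d) \<in> connected_in G S"
  using walk_connected[OF walk_step, of d S] by simp

lemma equiv_connected_in: "equiv (verts G) (connected_in G S)"
proof (rule equivI)
  show "refl_on (verts G) (connected_in G S)" by (auto simp: refl_on_def connected_in_def)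
  show "sym (connected_in G S)" by (auto simp: sym_def intro: connected_in_sym)
  show "trans (connected_in G S)" by (auto simp: trans_def intro: connected_in_trans)
  show "connected_in G S \<subseteq> verts G \<times> verts G" by (auto simp: connected_in_def)
qed

lemma not_distinct_map_decomp:
  assumes "\<not> distinct (map f W)"
  obtains W1 d W2 d' W3 where "W = W1 @ d # W2 @ d' # W3" "f d = f d'"
  using assms
proof (induction W arbitrary: thesis)
  case (Cons a W)
  show ?case
  proof (cases "f a \<in> f ` set W")
    case True
    then obtain d' where "d' \<in> set W" "f a = f d'" by blast
    then obtain W2 W3 where "W = W2 @ d' # W3" using split_list by metis
    then show ?thesis using Cons.prems(1)[of "[]" a W2 d' W3] \<open>f a = f d'\<close> by simp
  next
    case False
    then have "\<not> distinct (map f W)" using Cons.prems(2) by simp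
    then obtain W1 d W2 d' W3 where "W = W1 @ d # W2 @ d' # W3" "f d = f d'"
      using Cons.IH by blast
    then show ?thesis using Cons.prems(1)[of "a # W1"] by simp
  qed
qed simp

text \<open>At a repeated head the walk splits into two shorter closed walks, one of which is
  negative. If no head repeats but an edge does, that edge is traversed and at once reversed;
  deleting both steps removes the square of a sign.\<close>

lemma negative_closed_walk_cycle:
  assumes "walk G u W u" "walk_sign G W = -1"
  shows "\<exists>x W'. cycle_walk G x W' \<and> walk_sign G W' = -1 \<and> set (walk_edges W') \<subseteq> set (walk_edges W)"
  using assms
proof (induction "length W" arbitrary: u W rule: less_induct)
  case less
  note W = less.prems
  show ?case
  proof (cases "distinct (map (head G) W)")
    case False
    then obtain W1 d W2 d' W3 where d: "W = W1 @ d # W2 @ d' # W3" "head G d = head G d'"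
      by (rule not_distinct_map_decomp)
    have *: "W = (W1 @ [d]) @ (W2 @ [d']) @ W3" by (simp add: d(1))
    then obtain x y where xy: "walk G u (W1 @ [d]) x" "walk G x (W2 @ [d']) y" "walk G y W3 u"
      using W(1) unfolding * walk_append by blast
    then have "x = head G d" "y = head G d" using d(2) by (simp_all only: walk_snoc)
    then have w: "walk G x (W2 @ [d']) x" "walk G u ((W1 @ [d]) @ W3) u"
      using xy by (auto simp only: walk_append)
    have "walk_sign G ((W1 @ [d]) @ W3) * walk_sign G (W2 @ [d']) = -1"
      using W(2) by (simp add: d(1) algebra_simps)
    then have "walk_sign G ((W1 @ [d]) @ W3) = -1 \<or> walk_sign G (W2 @ [d']) = -1"
      using walk_sign_values[OF w(1)] walk_sign_values[OF w(2)] by auto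
    then show ?thesis
    proof
      assume "walk_sign G ((W1 @ [d]) @ W3) = -1"
      from less.hyps[OF _ w(2) this] show ?thesis by (force simp: d(1))
    next
      assume "walk_sign G (W2 @ [d']) = -1"
      from less.hyps[OF _ w(1) this] show ?thesis by (force simp: d(1))
    qed
  next
    case dist: True
    show ?thesis
    proof (cases "distinct (walk_edges W)")
      case True
      have "W \<noteq> []" using W(2) by auto
      then show ?thesis using W dist True by (auto simp: cycle_walk_def)
    next
      case False
      then obtain W1 d W2 d' W3 where d: "W = W1 @ d # W2 @ d' # W3" "fst d = fst d'"
        unfolding walk_edges_def by (rule not_distinct_map_decomp)
      have *: "W = (W1 @ [d]) @ W2 @ [d'] @ W3" by (simp add: d(1))
      then obtain x y z where xyz: "walk G u (W1 @ [d]) x" "walk G x W2 y" "walk G y [d'] z" "walk G z W3 u"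
        using W(1) unfolding * walk_append by blast
      have steps: "is_step G d" "is_step G d'" using xyz(1,3) by (auto simp: walk_snoc)
      have "d \<noteq> d'" using dist by (auto simp: d(1))
      then have "d' = rev_step d"
        using steps d(2) by (cases d; cases d') (auto simp: is_step_def rev_step_def)
      then have ends: "head G d' = tail G d" "tail G d' = head G d"
        using head_rev[OF steps(1)] by simp_all
      \<comment> \<open>The part between the two traversals begins and ends at
        \<open>head G d\<close>; a last step in it would repeat that head.\<close>
      have "W2 = []"
      proof (rule ccontr)
        assume "W2 \<noteq> []"
        then obtain W' a where a: "W2 = W' @ [a]" using rev_exhaust by blast
        have "head G a = y" using xyz(2) by (simp add: a walk_snoc)
        also have "y = head G d" using xyz(3) ends by simp
        finally show False using dist by (simp add: d(1) a)
      qed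
      have "walk G u W1 (tail G d)" "walk G (tail G d) W3 u"
        using xyz(1,3,4) ends by (auto simp: walk_snoc)
      then have w: "walk G u (W1 @ W3) u" unfolding walk_append by blast
      have "walk_sign G (W1 @ W3) = -1"
        using W(2) esign_values[OF step_edges[OF steps(1)]] \<open>W2 = []\<close> d(2)
        by (auto simp: d(1))
      from less.hyps[OF _ w this] show ?thesis by (force simp: d(1))
    qed
  qed
qed

text \<open>A closed walk at \<open>u\<close> stays in the class of \<open>u\<close>, so a negative
  circle extracted from it would consist of edges inside \<open>X\<close>.\<close>

lemma sign_balanced_closed_walk:
  assumes "sign_balanced G (component_edges G S X)" "connected_in G S `` {u} \<subseteq> X"
    and W: "walk G u W u" "set (walk_edges W) \<subseteq> S"
  shows "walk_sign G W = 1"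
proof (rule ccontr)
  assume "walk_sign G W \<noteq> 1"
  then obtain x W' where W': "cycle_walk G x W'" "walk_sign G W' = -1" "set (walk_edges W') \<subseteq> set (walk_edges W)"
    using negative_closed_walk_cycle[OF W(1)] walk_sign_values[OF W(1)] by blast
  have "set (walk_verts G u W) \<subseteq> X"
  proof
    fix y assume "y \<in> set (walk_verts G u W)"
    then obtain A B where "W = A @ B" "walk G u A y" using walk_reaches[OF W(1)] by metis
    then show "y \<in> X" using walk_connected[of u A y S] W(2) assms(2) by auto
  qed
  moreover have "ends G e \<noteq> []" if "e \<in> set (walk_edges W)" for e
    using walk_edge_link_or_loop[OF W(1) that] by (auto simp: link_or_loop_def)
  ultimately have "set (walk_edges W) \<subseteq> component_edges G S X"
    using ends_walk_edge[OF W(1)] W(2) unfolding component_edges_def by blast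
  then have "set (walk_edges W') \<subseteq> component_edges G S X" using W'(3) by blast
  then show False
    using assms(1) negative_cycle_walk[OF W'(1,2)] unfolding sign_balanced_def by blast
qed

section \<open>Switching functions obtained from walk signs\<close>

definition reach_sign :: "'e set \<Rightarrow> 'v \<Rightarrow> 'v \<Rightarrow> int" where
  "reach_sign S u v = walk_sign G (SOME W. walk G u W v \<and> set (walk_edges W) \<subseteq> S)"

lemma reach_sign_walk:
  assumes "(u, v) \<in> connected_in G S"
  obtains W where "walk G u W v" "set (walk_edges W) \<subseteq> S" "reach_sign S u v = walk_sign G W"
proof -
  have "\<exists>W. walk G u W v \<and> set (walk_edges W) \<subseteq> S"
    using walk_if_connected[OF assms] by blast
  from someI_ex[OF this] show thesis using that unfolding reach_sign_def by blast
qed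

text \<open>Under \<open>pos\<close> the arbitrary choice of walks in \<open>reach_sign\<close> is
  harmless: going to the tail, over \<open>d\<close>, and back along the walk chosen for the head is
  a closed walk at \<open>u\<close>, hence of sign 1.\<close>

lemma reach_sign_step:
  assumes pos: "\<And>W. walk G u W u \<Longrightarrow> set (walk_edges W) \<subseteq> S \<Longrightarrow> walk_sign G W = 1"
    and d: "is_step G d" "fst d \<in> S" "(u, tail G d) \<in> connected_in G S"
  shows "reach_sign S u (head G d) = esign G (fst d) * reach_sign S u (tail G d)"
proof -
  obtain W where W: "walk G u W (tail G d)" "set (walk_edges W) \<subseteq> S" "reach_sign S u (tail G d) = walk_sign G W"
    using reach_sign_walk[OF d(3)] .
  have "(u, head G d) \<in> connected_in G S"
    using connected_in_trans[OF d(3) step_connected[OF d(1,2)]] .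
  then obtain W' where W': "walk G u W' (head G d)" "set (walk_edges W') \<subseteq> S" "reach_sign S u (head G d) = walk_sign G W'"
    by (rule reach_sign_walk)
  have "walk G u (W @ [d]) (head G d)" using W(1) d(1) by (simp add: walk_snoc)
  then have "walk G u ((W @ [d]) @ rev_walk W') u"
    using walk_rev_walk[OF W'(1)] by (meson walk_append)
  moreover have "set (walk_edges ((W @ [d]) @ rev_walk W')) \<subseteq> S" using W(2) W'(2) d(2) by simp
  ultimately have "walk_sign G ((W @ [d]) @ rev_walk W') = 1" by (rule pos)
  then have "walk_sign G W * esign G (fst d) * walk_sign G W' = 1" by simp
  then show ?thesis
    unfolding W(3) W'(3)
    using walk_sign_values[OF W(1)] walk_sign_values[OF W'(1)] esign_values[OF step_edges[OF d(1)]] by auto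
qed

lemma prod_power_count_list:
  assumes "finite V" "set xs \<subseteq> V"
  shows "(\<Prod>x\<in>V. f x ^ count_list xs x) = (\<Prod>x\<leftarrow>xs. f x :: int)"
  using assms(2)
proof (induction xs)
  case (Cons a xs)
  have "(\<Prod>x\<in>V. f x ^ count_list (a # xs) x) = (\<Prod>x\<in>V. (if x = a then f x else 1) * f x ^ count_list xs x)"
    by (intro prod.cong) auto
  also have "\<dots> = f a * (\<Prod>x\<in>V. f x ^ count_list xs x)"
    using assms(1) Cons.prems by (simp add: prod.distrib prod.delta)
  finally show ?case using Cons by simp
qed simp

text \<open>Each edge sign is the product of the values of \<open>t\<close> at its two ends. Over
  the whole circle every vertex then occurs as often as its degree, twice, and the squares are 1.
  This uses 2-regularity directly, with no walk around the circle.\<close>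

lemma circle_sign_potential:
  assumes C: "circle G C" "C \<subseteq> edges G"
    and t: "\<And>x. x \<in> vset G C \<Longrightarrow> t x \<in> {1, -1}"
    and edge: "\<And>d. is_step G d \<Longrightarrow> fst d \<in> C \<Longrightarrow> t (head G d) = esign G (fst d) * t (tail G d)"
  shows "set_sign G C = 1"
proof -
  have fin: "finite C" "finite (vset G C)"
    using C(2) finite_edges by (auto simp: vset_def intro: finite_subset)
  have "esign G e = (\<Prod>x\<in>vset G C. t x ^ count_list (ends G e) x)" if e: "e \<in> C" for e
  proof -
    have "link_or_loop G e" using C(1) e by (auto simp: circle_def)
    then have st: "is_step G (e, 0)" by (simp add: is_step_def)
    have tl: "tail G (e, 0) \<in> vset G C"
      using set_ends_step[OF st] e by (auto simp: vset_def)
    have "set (ends G e) \<subseteq> vset G C" using e by (auto simp: vset_def)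
    then have "(\<Prod>x\<in>vset G C. t x ^ count_list (ends G e) x) = (\<Prod>x\<leftarrow>ends G e. t x)"
      by (rule prod_power_count_list[OF fin(2)])
    also have "\<dots> = t (tail G (e, 0)) * t (head G (e, 0))"
      using st by (cases rule: step_cases) auto
    also have "\<dots> = esign G e"
      using edge[OF st] t[OF tl] e by auto
    finally show ?thesis by simp
  qed
  then have "set_sign G C = (\<Prod>e\<in>C. \<Prod>x\<in>vset G C. t x ^ count_list (ends G e) x)"
    unfolding set_sign_def by (intro prod.cong) auto
  also have "\<dots> = (\<Prod>x\<in>vset G C. t x ^ degree G C x)"
    by (subst prod.swap) (simp add: degree_def power_sum)
  also have "\<dots> = 1"
  proof (intro prod.neutral ballI)
    fix x assume x: "x \<in> vset G C"
    then have "degree G C x = 2" using C(1) by (auto simp: circle_def)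
    then show "t x ^ degree G C x = 1" using t[OF x] by auto
  qed
  finally show ?thesis .
qed

end

section \<open>The dimension\<close>

text \<open>Evaluating a linear relation at coordinate \<open>j\<close> isolates the coefficient of
  \<open>g j\<close>.\<close>

lemma dual_family_independent:
  assumes "finite I" and g: "\<And>i j. i \<in> I \<Longrightarrow> j \<in> I \<Longrightarrow> g i j = (if i = j then 1 else 0 :: 'k :: field)"
  shows "fspace.dim (fspace.span (g ` I)) = card I"
proof -
  have inj: "inj_on g I"
    by (rule inj_onI) (metis g zero_neq_one)
  have "fspace.independent (g ` I)"
  proof (rule fspace.independent_if_scalars_zero)
    fix f x
    assume sum: "(\<Sum>x\<in>g ` I. fscale (f x) x) = 0" and "x \<in> g ` I"
    then obtain j where j: "j \<in> I" "x = g j" by blast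
    have "0 = (\<Sum>i\<in>I. fscale (f (g i)) (g i)) j"
      using sum inj by (simp add: sum.reindex)
    also have "\<dots> = (\<Sum>i\<in>I. f (g i) * g i j)"
      by (simp add: sum_apply fscale_apply)
    also have "\<dots> = (\<Sum>i\<in>I. if i = j then f (g i) else 0)"
      using g[OF _ j(1)] by (intro sum.cong) auto
    also have "\<dots> = f x" using assms(1) j by simp
    finally show "f x = 0" by simp
  qed (use assms(1) in simp)
  then show ?thesis
    by (simp add: fspace.dim_eq_card_independent card_image[OF inj] fspace.dim_span)
qed

context gain_signed_graph
begin

section \<open>The span together with e_0, where only signs matter\<close>

abbreviation extended_span :: "'e set \<Rightarrow> ('v option \<Rightarrow> 'k) set" where
  "extended_span S \<equiv> fspace.span (insert (basis_vec None) (edge_vectors G S))"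

lemma e0_in_extended_span: "basis_vec None \<in> extended_span S"
  by (intro fspace.span_base) simp

lemma edge_in_extended_span: "x \<in> fspace.span (edge_vectors G S) \<Longrightarrow> x \<in> extended_span S"
  using fspace.span_mono[OF subset_insertI] by blast

text \<open>With e_0 available the gain term of the walk vector can be subtracted, so from here on
  gains disappear.\<close>

lemma walk_in_extended_span:
  assumes "walk G u W v" "set (walk_edges W) \<subseteq> S"
  shows "fscale (of_int (walk_sign G W)) (basis_vec (Some v)) - basis_vec (Some u) \<in> extended_span S"
proof -
  have "walk_vec G u W v - fscale (walk_gain G W) (basis_vec None) \<in> extended_span S"
    by (intro fspace.span_diff fspace.span_scale e0_in_extended_span
        edge_in_extended_span walk_vec_in_span[OF assms])
  moreover have "walk_vec G u W v - fscale (walk_gain G W) (basis_vec None)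
      = fscale (of_int (walk_sign G W)) (basis_vec (Some v)) - basis_vec (Some u)"
    by (rule ext) (simp add: walk_vec_def fscale_apply)
  ultimately show ?thesis by argo
qed

lemma vertex_in_extended_span_walk:
  assumes u: "basis_vec (Some u) \<in> extended_span S" and W: "walk G u W v" "set (walk_edges W) \<subseteq> S"
  shows "basis_vec (Some v) \<in> extended_span S"
proof -
  let ?\<sigma> = "of_int (walk_sign G W) :: 'k"
  have "fscale ?\<sigma> (fscale ?\<sigma> (basis_vec (Some v)) - basis_vec (Some u) + basis_vec (Some u)) \<in> extended_span S"
    by (intro fspace.span_scale fspace.span_add[OF walk_in_extended_span[OF W] u])
  moreover have "fscale ?\<sigma> (fscale ?\<sigma> (basis_vec (Some v)) - basis_vec (Some u) + basis_vec (Some u))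
     = basis_vec (Some v)"
    using walk_sign_values[OF W(1)] by (intro ext) (auto simp: fscale_apply)
  ultimately show ?thesis by argo
qed

text \<open>A half edge gives the basis vector of its vertex, which walks carry to \<open>v\<close>.
  Without half edges there is a negative circle, hence a negative closed walk at \<open>v\<close>,
  whose vector is -2 e_v up to a multiple of e_0.\<close>

lemma unbalanced_vertex_in_extended_span:
  assumes S: "S \<subseteq> edges G" and v: "v \<in> verts G" and two: "(2 :: 'k) \<noteq> 0"
    and unbalanced: "\<not> sign_balanced G (component_edges G S (connected_in G S `` {v}))"
  shows "basis_vec (Some v) \<in> extended_span S"
proof (cases "\<exists>h \<in> component_edges G S (connected_in G S `` {v}). half_edge G h")
  case True
  then obtain h where h: "half_edge G h" "h \<in> S" "(v, hd (ends G h)) \<in> connected_in G S"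
    using half_edge_ends by (auto simp: component_edges_def)
  let ?x = "hd (ends G h)" and ?\<tau> = "of_int (orient G h 0) :: 'k"
  have "fscale ?\<tau> (zvec G (Some h) - fscale (gain G h) (basis_vec None)) \<in> extended_span S"
    by (intro fspace.span_scale fspace.span_diff e0_in_extended_span edge_in_extended_span zvec_in_span h(2))
  moreover have "fscale ?\<tau> (zvec G (Some h) - fscale (gain G h) (basis_vec None)) = basis_vec (Some ?x)"
    unfolding zvec_half_edge[OF h(1)]
    using half_edge_orient_values[OF h(1)] by (intro ext) (auto simp: fscale_apply)
  ultimately have "basis_vec (Some ?x) \<in> extended_span S" by argo
  moreover obtain W where "walk G ?x W v" "set (walk_edges W) \<subseteq> S"
    using walk_if_connected[OF connected_in_sym[OF h(3)]] .
  ultimately show ?thesis by (rule vertex_in_extended_span_walk)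
next
  case False
  then obtain C where C: "C \<subseteq> component_edges G S (connected_in G S `` {v})" "negative_circle G C"
    using unbalanced unfolding sign_balanced_def by blast
  \<comment> \<open>If all closed walks at \<open>v\<close> were positive, \<open>reach_sign\<close>
    would be a switching function on the component and would make the negative circle
    positive.\<close>
  have "\<exists>W. walk G v W v \<and> set (walk_edges W) \<subseteq> S \<and> walk_sign G W \<noteq> 1"
  proof (rule ccontr)
    assume "\<nexists>W. walk G v W v \<and> set (walk_edges W) \<subseteq> S \<and> walk_sign G W \<noteq> 1"
    then have pos: "walk_sign G W = 1" if "walk G v W v" "set (walk_edges W) \<subseteq> S" for W
      using that by blast
    have CS: "C \<subseteq> S" using C(1) by (auto simp: component_edges_def)
    have conn: "(v, x) \<in> connected_in G S" if "x \<in> vset G C" for x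
      using that C(1) by (auto simp: vset_def component_edges_def)
    have "set_sign G C = 1"
    proof (rule circle_sign_potential[where t = "reach_sign S v"])
      show "circle G C" using C(2) by (simp add: negative_circle_def)
      show "C \<subseteq> edges G" using CS S by blast
      show "reach_sign S v x \<in> {1, -1}" if x: "x \<in> vset G C" for x
        using reach_sign_walk[OF conn[OF x]] walk_sign_values by (metis insertCI)
      show "reach_sign S v (head G d) = esign G (fst d) * reach_sign S v (tail G d)"
        if d: "is_step G d" "fst d \<in> C" for d
      proof (rule reach_sign_step[OF pos d(1)])
        show "fst d \<in> S" using d(2) CS by blast
        show "(v, tail G d) \<in> connected_in G S"
          using set_ends_step[OF d(1)] d(2) by (intro conn) (auto simp: vset_def)
      qed
    qed
    then show False using C(2) by (simp add: negative_circle_def)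
  qed
  then obtain W where W: "walk G v W v" "set (walk_edges W) \<subseteq> S" "walk_sign G W = -1"
    using walk_sign_values by blast
  have "fscale (- 1 / 2) (fscale (of_int (walk_sign G W)) (basis_vec (Some v)) - basis_vec (Some v)) \<in> extended_span S"
    by (intro fspace.span_scale walk_in_extended_span[OF W(1,2)])
  moreover have "fscale (- 1 / 2) (fscale (of_int (walk_sign G W)) (basis_vec (Some v)) - basis_vec (Some v))
     = (basis_vec (Some v) :: 'v option \<Rightarrow> 'k)"
    using two by (intro ext) (simp add: W(3) fscale_apply field_simps)
  ultimately show ?thesis by argo
qed

section \<open>Component roots and the reduced basis\<close>

definition component_root :: "'e set \<Rightarrow> 'v \<Rightarrow> 'v" where
  "component_root S v = (SOME x. x \<in> connected_in G S `` {v})"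

abbreviation in_balanced :: "'e set \<Rightarrow> 'v \<Rightarrow> bool" where
  "in_balanced S v \<equiv> sign_balanced G (component_edges G S (connected_in G S `` {v}))"

text \<open>
  The value 0 on unbalanced components makes \<open>reduced_vec S v\<close> equal to the basis vector of \<open>v\<close> there.
\<close>

definition potential :: "'e set \<Rightarrow> 'v \<Rightarrow> int" where
  "potential S v = (if in_balanced S v then reach_sign S (component_root S v) v else 0)"

definition reduced_vec :: "'e set \<Rightarrow> 'v \<Rightarrow> ('v option \<Rightarrow> 'k)" where
  "reduced_vec S v = basis_vec (Some v) - fscale (of_int (potential S v)) (basis_vec (Some (component_root S v)))"

lemma connected_class_eq: "(u, v) \<in> connected_in G S \<Longrightarrow> connected_in G S `` {u} = connected_in G S `` {v}"
  by (rule equiv_class_eq[OF equiv_connected_in])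

lemma component_root_eq: "(u, v) \<in> connected_in G S \<Longrightarrow> component_root S u = component_root S v"
  using connected_class_eq unfolding component_root_def by metis

lemma component_root_connected:
  assumes "v \<in> verts G"
  shows "(v, component_root S v) \<in> connected_in G S"
proof -
  have "v \<in> connected_in G S `` {v}" using assms by (simp add: connected_in_def)
  then have "component_root S v \<in> connected_in G S `` {v}" unfolding component_root_def by (rule someI)
  then show ?thesis by simp
qed

lemma in_balanced_eq: "(u, v) \<in> connected_in G S \<Longrightarrow> in_balanced S u = in_balanced S v"
  using connected_class_eq by metis

lemma balanced_closed_walk_positive:
  assumes "in_balanced S v" "v \<in> verts G" "walk G (component_root S v) W (component_root S v)" "set (walk_edges W) \<subseteq> S"
  shows "walk_sign G W = 1"
proof (rule sign_balanced_closed_walk[OF assms(1) _ assms(3,4)])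
  show "connected_in G S `` {component_root S v} \<subseteq> connected_in G S `` {v}"
    using connected_class_eq[OF component_root_connected[OF assms(2)]] by simp
qed

lemma potential_step:
  assumes d: "is_step G d" "fst d \<in> S"
  shows "potential S (head G d) = esign G (fst d) * potential S (tail G d)"
proof -
  note con = step_connected[OF d]
  have tl: "tail G d \<in> verts G" using step_verts[OF d(1)] by simp
  show ?thesis
  proof (cases "in_balanced S (tail G d)")
    case True
    have "reach_sign S (component_root S (tail G d)) (head G d) = esign G (fst d) * reach_sign S (component_root S (tail G d)) (tail G d)"
      using balanced_closed_walk_positive[OF True tl]
      by (rule reach_sign_step[OF _ d connected_in_sym[OF component_root_connected[OF tl]]])
    then show ?thesis
      using True in_balanced_eq[OF con] component_root_eq[OF con] by (simp add: potential_def)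
  next
    case False
    then show ?thesis using in_balanced_eq[OF con] by (simp add: potential_def)
  qed
qed

lemma potential_half_edge:
  assumes "half_edge G h" "h \<in> S"
  shows "potential S (hd (ends G h)) = 0"
proof -
  let ?x = "hd (ends G h)"
  have "?x \<in> verts G" using half_edge_ends[OF assms(1)] ends_verts[of h] assms(1) by (auto simp: half_edge_def)
  then have "(?x, ?x) \<in> connected_in G S" by (simp add: connected_in_def)
  moreover have "ends G h \<noteq> []" using assms(1) by (auto simp: half_edge_def)
  ultimately have "h \<in> component_edges G S (connected_in G S `` {?x})"
    using half_edge_ends[OF assms(1)] assms(2) by (simp add: component_edges_def)
  then have "\<not> in_balanced S ?x" using assms(1) unfolding sign_balanced_def by blast
  then show ?thesis by (simp add: potential_def)
qed

lemma potential_root: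
  assumes "v \<in> verts G" "in_balanced S v" "component_root S v = v"
  shows "potential S v = 1"
proof -
  have "(v, v) \<in> connected_in G S" using assms(1) by (simp add: connected_in_def)
  then obtain W where "walk G v W v" "set (walk_edges W) \<subseteq> S" "reach_sign S v v = walk_sign G W"
    by (rule reach_sign_walk)
  then show ?thesis
    using balanced_closed_walk_positive[OF assms(2,1)] assms(2,3) by (simp add: potential_def)
qed

lemma reduced_vec_in_extended_span:
  assumes "S \<subseteq> edges G" "v \<in> verts G" "(2 :: 'k) \<noteq> 0"
  shows "reduced_vec S v \<in> extended_span S"
proof (cases "in_balanced S v")
  case True
  obtain W where W: "walk G (component_root S v) W v" "set (walk_edges W) \<subseteq> S" "reach_sign S (component_root S v) v = walk_sign G W"
    using reach_sign_walk[OF connected_in_sym[OF component_root_connected[OF assms(2)]]] .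
  let ?\<sigma> = "of_int (walk_sign G W) :: 'k"
  have "fscale ?\<sigma> (fscale ?\<sigma> (basis_vec (Some v)) - basis_vec (Some (component_root S v))) \<in> extended_span S"
    by (intro fspace.span_scale walk_in_extended_span[OF W(1,2)])
  moreover have "fscale ?\<sigma> (fscale ?\<sigma> (basis_vec (Some v)) - basis_vec (Some (component_root S v))) = reduced_vec S v"
    using walk_sign_values[OF W(1)] True W(3)
    by (intro ext) (auto simp: fscale_apply reduced_vec_def potential_def algebra_simps)
  ultimately show ?thesis by argo
next
  case False
  have "reduced_vec S v = basis_vec (Some v)"
    using False by (intro ext) (simp add: reduced_vec_def potential_def fscale_apply)
  then show ?thesis using unbalanced_vertex_in_extended_span[OF assms(1,2,3) False] by argo
qed

text \<open>Roots of unbalanced components are included: their reduced vector is e_v, and only for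
  roots of balanced components is it 0.\<close>

definition nonroots :: "'e set \<Rightarrow> 'v set" where
  "nonroots S = {v \<in> verts G. \<not> (in_balanced S v \<and> component_root S v = v)}"

definition reduced_family :: "'e set \<Rightarrow> 'v option \<Rightarrow> ('v option \<Rightarrow> 'k)" where
  "reduced_family S i = (case i of None \<Rightarrow> basis_vec None | Some v \<Rightarrow> reduced_vec S v)"

text \<open>Apart from its own coordinate, a reduced vector can be nonzero only at the root of its
  component. That root is an index only when the component is unbalanced, and there the potential is
  0.\<close>

lemma reduced_family_dual:
  assumes "i \<in> insert None (Some ` nonroots S)" "j \<in> insert None (Some ` nonroots S)"
  shows "reduced_family S i j = (if i = j then 1 else 0)"
proof (cases i)
  case None
  then show ?thesis by (auto simp: reduced_family_def basis_vec_def)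
next
  case (Some v)
  have v: "v \<in> verts G" using assms(1) Some by (auto simp: nonroots_def)
  show ?thesis
  proof (cases j)
    case None
    then show ?thesis using Some by (simp add: reduced_family_def reduced_vec_def basis_vec_def fscale_apply)
  next
    case j: (Some w)
    have "potential S v = 0" if "component_root S v = w"
    proof -
      have con: "(v, w) \<in> connected_in G S" using component_root_connected[OF v, of S] that by simp
      have "component_root S w = w" using component_root_eq[OF con] that by simp
      moreover have "w \<in> nonroots S" using assms(2) j by auto
      ultimately have "\<not> in_balanced S w" by (auto simp: nonroots_def)
      then show ?thesis using in_balanced_eq[OF con] by (simp add: potential_def)
    qed
    then show ?thesis using Some j
      by (auto simp: reduced_family_def reduced_vec_def basis_vec_def fscale_apply)
  qed
qed

lemma extended_span_eq:
  assumes S: "S \<subseteq> edges G" and two: "(2 :: 'k) \<noteq> 0"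
  shows "extended_span S = fspace.span (reduced_family S ` insert None (Some ` nonroots S))"
    (is "_ = fspace.span ?B")
proof -
  have e0: "basis_vec None \<in> fspace.span ?B"
    by (intro fspace.span_base) (auto simp: reduced_family_def image_iff)
  have red: "reduced_vec S v \<in> fspace.span ?B" if "v \<in> verts G" for v
  proof (cases "v \<in> nonroots S")
    case True
    then have "reduced_vec S v \<in> ?B"
      by (intro image_eqI[of _ _ "Some v"]) (auto simp: reduced_family_def)
    then show ?thesis by (rule fspace.span_base)
  next
    case False
    then have "component_root S v = v" "potential S v = 1"
      using that potential_root by (auto simp: nonroots_def)
    then have "reduced_vec S v = 0"
      by (intro ext) (simp add: reduced_vec_def fscale_apply)
    then show ?thesis using fspace.span_zero by metis
  qed
  have "zvec G (Some e) \<in> fspace.span ?B" if e: "e \<in> S" for e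
  proof -
    have eE: "e \<in> edges G" using S e by blast
    then have "length (ends G e) = 0 \<or> length (ends G e) = 1 \<or> length (ends G e) = 2"
      using length_ends[of e] by linarith
    then consider "loose_edge G e" | "half_edge G e" | "link_or_loop G e"
      using eE unfolding loose_edge_def half_edge_def link_or_loop_def by blast
    then show ?thesis
    proof cases
      case 1
      then show ?thesis unfolding zvec_loose_edge[OF 1] by (intro fspace.span_scale e0)
    next
      case 2
      let ?x = "hd (ends G e)"
      have x: "?x \<in> verts G" using half_edge_ends[OF 2] ends_verts[OF eE] by auto
      have "reduced_vec S ?x = basis_vec (Some ?x)"
        using potential_half_edge[OF 2 e] by (intro ext) (simp add: reduced_vec_def fscale_apply)
      then have "basis_vec (Some ?x) \<in> fspace.span ?B" using red[OF x] by argo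
      then show ?thesis unfolding zvec_half_edge[OF 2]
        by (intro fspace.span_add fspace.span_scale e0)
    next
      case 3
      define d where "d = (e, 0::nat)"
      have d: "is_step G d" "fst d = e" using 3 by (auto simp: d_def is_step_def)
      have v: "tail G d \<in> verts G" "head G d \<in> verts G" using step_verts[OF d(1)] by auto
      have rt: "component_root S (head G d) = component_root S (tail G d)"
        using component_root_eq[OF step_connected[OF d(1), of S]] d(2) e by simp
      have pot: "potential S (head G d) = esign G e * potential S (tail G d)"
        using potential_step[OF d(1), of S] d(2) e by simp
      \<comment> \<open>Replacing basis vectors by reduced vectors in the edge vector changes
        nothing: both ends have the same root, whose coefficients cancel since the potential
        switches by the sign of \<open>e\<close>.\<close>
      have "fscale (gain G e) (basis_vec None) + fscale (of_int (orient G e (snd d)))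
          (reduced_vec S (tail G d) - fscale (of_int (esign G e)) (reduced_vec S (head G d))) \<in> fspace.span ?B"
        by (intro fspace.span_add fspace.span_scale fspace.span_diff e0 red v)
      moreover have "fscale (gain G e) (basis_vec None) + fscale (of_int (orient G e (snd d)))
          (reduced_vec S (tail G d) - fscale (of_int (esign G e)) (reduced_vec S (head G d))) = zvec G (Some e)"
        unfolding zvec_step[OF d(1), unfolded d(2)]
        using esign_values[OF eE] pot
        by (intro ext) (auto simp del: zvec.simps simp add: reduced_vec_def fscale_apply rt algebra_simps)
      ultimately show ?thesis by argo
    qed
  qed
  then have "insert (basis_vec None) (edge_vectors G S) \<subseteq> fspace.span ?B"
    using e0 by (auto simp: edge_vectors_def simp del: zvec.simps)
  moreover have "?B \<subseteq> extended_span S"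
    using e0_in_extended_span[of S] reduced_vec_in_extended_span[OF S _ two]
    by (auto simp: reduced_family_def nonroots_def)
  ultimately show ?thesis
    by (intro equalityI fspace.span_minimal fspace.subspace_span)
qed

text \<open>Every component contains exactly one root, so balanced components correspond to their
  roots.\<close>

lemma card_nonroots: "card (nonroots S) + balanced_components G S = card (verts G)"
proof -
  let ?R = "{v \<in> verts G. in_balanced S v \<and> component_root S v = v}"
  have "bij_betw (\<lambda>v. connected_in G S `` {v}) ?R
      {X \<in> components G S. sign_balanced G (component_edges G S X)}"
  proof (rule bij_betw_imageI)
    show "inj_on (\<lambda>v. connected_in G S `` {v}) ?R"
    proof (rule inj_onI)
      fix u v assume uv: "u \<in> ?R" "v \<in> ?R" and "connected_in G S `` {u} = connected_in G S `` {v}"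
      then have "component_root S u = component_root S v" unfolding component_root_def by (simp only:)
      moreover have "component_root S u = u" "component_root S v = v" using uv by blast+
      ultimately show "u = v" by argo
    qed
    show "(\<lambda>v. connected_in G S `` {v}) ` ?R = {X \<in> components G S. sign_balanced G (component_edges G S X)}"
    proof (intro equalityI subsetI)
      fix X assume "X \<in> {X \<in> components G S. sign_balanced G (component_edges G S X)}"
      then have X: "X \<in> verts G // connected_in G S" "sign_balanced G (component_edges G S X)"
        by (simp_all add: components_def)
      from X(1) obtain v where v: "v \<in> verts G" "X = connected_in G S `` {v}"
        by (rule quotientE)
      have bal: "in_balanced S v" using X(2) v(2) by simp
      note con = component_root_connected[OF v(1), of S]
      have "component_root S v \<in> verts G" using con by (simp add: connected_in_def)
      then have "component_root S v \<in> ?R"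
        using in_balanced_eq[OF con] component_root_eq[OF con, symmetric] bal by blast
      moreover have "X = connected_in G S `` {component_root S v}" using connected_class_eq[OF con] v(2) by argo
      ultimately show "X \<in> (\<lambda>v. connected_in G S `` {v}) ` ?R" by blast
    next
      fix X assume "X \<in> (\<lambda>v. connected_in G S `` {v}) ` ?R"
      then obtain v where v: "v \<in> verts G" "in_balanced S v" "X = connected_in G S `` {v}" by blast
      then show "X \<in> {X \<in> components G S. sign_balanced G (component_edges G S X)}"
        unfolding components_def using quotientI[OF v(1)] by simp
    qed
  qed
  then have "balanced_components G S = card ?R"
    unfolding balanced_components_def by (rule bij_betw_same_card[symmetric])
  moreover have "card (nonroots S) + card ?R = card (verts G)"
  proof -
    have union: "nonroots S \<union> ?R = verts G" and disj: "nonroots S \<inter> ?R = {}"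
      unfolding nonroots_def by blast+
    have "finite (nonroots S)" "finite ?R" using finite_verts by (simp_all add: nonroots_def)
    from card_Un_disjoint[OF this disj] show ?thesis unfolding union by (rule sym)
  qed
  ultimately show ?thesis by simp
qed

lemma dim_extended_span:
  assumes "S \<subseteq> edges G" "(2 :: 'k) \<noteq> 0"
  shows "fspace.dim (extended_span S) + balanced_components G S = card (verts G) + 1"
proof -
  have fin: "finite (nonroots S)" using finite_verts by (simp add: nonroots_def)
  have "fspace.dim (extended_span S) = card (insert None (Some ` nonroots S))"
    unfolding extended_span_eq[OF assms]
    using fin reduced_family_dual by (intro dual_family_independent) blast+
  also have "\<dots> = 1 + card (nonroots S)"
    using fin by (simp add: card_image)
  finally show ?thesis using card_nonroots[of S] by simp
qed

section \<open>The rank formula as a dimension\<close>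

lemma dim_span_insert:
  assumes "finite A" "x \<notin> fspace.span A"
  shows "fspace.dim (fspace.span (insert x A)) = fspace.dim (fspace.span A) + 1"
proof -
  obtain B where B: "B \<subseteq> A" "fspace.independent B" "A \<subseteq> fspace.span B"
    using fspace.basis_exists by metis
  have finB: "finite B" using B(1) assms(1) finite_subset by blast
  have sp: "fspace.span B = fspace.span A"
    using B(1,3) by (metis fspace.span_mono fspace.span_span subset_antisym)
  then have x: "x \<notin> fspace.span B" using assms(2) by simp
  then have "fspace.independent (insert x B)" using B(2) by (simp add: fspace.independent_insert)
  moreover have "fspace.span (insert x B) = fspace.span (insert x A)"
    using sp by (simp add: fspace.span_insert)
  moreover have "x \<notin> B" using x fspace.span_base by metis
  ultimately have "fspace.dim (fspace.span (insert x A)) = card B + 1"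
    using finB by (metis Suc_eq_plus1 card_insert_disjoint fspace.dim_span_eq_card_independent)
  then show ?thesis using fspace.dim_span_eq_card_independent[OF B(2)] sp by simp
qed

text \<open>The extended span has dimension n + 1 - b in all cases. Adjoining e_0 raises the
  dimension by one exactly when e_0 was not yet in the span, that is, for hyperbalanced sets without
  the extra element; this is the difference between the two values of
  \<open>hyperfrustration\<close>.\<close>

lemma graph_rank_eq_dim:
  assumes S: "S \<subseteq> extended_edges G" and two: "(2 :: 'k) \<noteq> 0"
  shows "graph_rank G S = int (fspace.dim (fspace.span (zvec G ` S)))"
proof -
  let ?S = "Some -` S"
  have SE: "?S \<subseteq> edges G" using S by (auto simp: extended_edges_def)
  note dim = dim_extended_span[OF SE two]
  have fin: "finite (edge_vectors G ?S)"
    using SE finite_edges by (auto simp: edge_vectors_def intro: finite_subset)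
  have split: "S = Some ` ?S \<or> S = insert None (Some ` ?S)"
  proof -
    have "x = None \<or> x \<in> Some ` ?S" if "x \<in> S" for x using that by (cases x) auto
    then show ?thesis by auto
  qed
  show ?thesis
  proof (cases "None \<in> S")
    case True
    then have "S = insert None (Some ` ?S)" using split by auto
    then have "zvec G ` S = insert (basis_vec None) (edge_vectors G ?S)"
      unfolding edge_vectors_def by (metis (no_types) image_image image_insert zvec.simps(1))
    then show ?thesis
      using dim True by (simp add: graph_rank_def hyperfrustration_def)
  next
    case False
    then have "S = Some ` ?S" using split by auto
    then have z: "zvec G ` S = edge_vectors G ?S"
      unfolding edge_vectors_def by (metis (no_types) image_image)
    show ?thesis
    proof (cases "hyperbalanced G ?S")
      case True
      then show ?thesis
        using dim_span_insert[OF fin hyperbalanced_not_in_span[OF SE True two]] dim False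
        by (simp add: graph_rank_def hyperfrustration_def z)
    next
      case hyp: False
      then show ?thesis
        using fspace.span_redundant[OF hyperfrustrated_in_span[OF hyp]] dim False
        by (simp add: graph_rank_def hyperfrustration_def z)
    qed
  qed
qed

end

section \<open>Vector matroids\<close>

text \<open>Injectivity is demanded because different elements may have the same vector, such as the
  extra element and a loose edge of gain 1; they must count as parallel.\<close>

definition vector_independent_sets :: "'a set \<Rightarrow> ('a \<Rightarrow> 'i \<Rightarrow> 'k :: field) \<Rightarrow> 'a set set" where
  "vector_independent_sets E z = {X. X \<subseteq> E \<and> inj_on z X \<and> fspace.independent (z ` X)}"

text \<open>If no element of \<open>Y\<close> extended \<open>X\<close>, all vectors of
  \<open>Y\<close> would lie in the span of those of \<open>X\<close>, against the bound on
  independent families in a span.\<close>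

lemma vector_matroid:
  assumes "finite E"
  shows "matroid E (vector_independent_sets E z)"
  unfolding matroid_def
proof (intro conjI ballI allI impI)
  fix X Y
  assume X: "X \<in> vector_independent_sets E z" and Y: "Y \<in> vector_independent_sets E z"
    and less: "card X < card Y"
  have fin: "finite X" "finite Y"
    using X Y assms by (auto simp: vector_independent_sets_def intro: finite_subset)
  show "\<exists>y\<in>Y - X. insert y X \<in> vector_independent_sets E z"
  proof (rule ccontr)
    assume none: "\<not> (\<exists>y\<in>Y - X. insert y X \<in> vector_independent_sets E z)"
    have "z y \<in> fspace.span (z ` X)" if y: "y \<in> Y" for y
    proof (rule ccontr)
      assume ns: "z y \<notin> fspace.span (z ` X)"
      then have nz: "z y \<notin> z ` X" using fspace.span_base by metis
      have "fspace.independent (z ` insert y X)"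
        using ns X by (simp add: vector_independent_sets_def fspace.independent_insert)
      moreover have "inj_on z (insert y X)" "insert y X \<subseteq> E"
        using nz X Y y by (auto simp: vector_independent_sets_def)
      ultimately have "insert y X \<in> vector_independent_sets E z"
        by (simp add: vector_independent_sets_def)
      then show False using none nz y by blast
    qed
    then have "z ` Y \<subseteq> fspace.span (z ` X)" by blast
    then have "card (z ` Y) \<le> card (z ` X)"
      using fspace.independent_span_bound[of "z ` X" "z ` Y"] Y fin(1)
      by (simp add: vector_independent_sets_def)
    then show False
      using less X Y by (simp add: vector_independent_sets_def card_image)
  qed
next
  fix X Y assume "X \<in> vector_independent_sets E z" "Y \<subseteq> X"
  then show "Y \<in> vector_independent_sets E z"
    unfolding vector_independent_sets_def
    using fspace.independent_mono[OF _ image_mono] by (auto intro: inj_on_subset)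
qed (use assms in \<open>auto simp: vector_independent_sets_def fspace.independent_empty\<close>)

lemma vector_matroid_rank:
  assumes "finite E" "S \<subseteq> E"
  shows "matroid_rank (vector_independent_sets E z) S = fspace.dim (fspace.span (z ` S))"
  unfolding matroid_rank_def
proof (rule Max_eqI)
  have "finite {X \<in> vector_independent_sets E z. X \<subseteq> S}"
    using assms by (auto intro: finite_subset[of _ "Pow S"] finite_subset)
  then show "finite (card ` {X \<in> vector_independent_sets E z. X \<subseteq> S})" by simp
next
  obtain B where B: "B \<subseteq> z ` S" "fspace.independent B" "z ` S \<subseteq> fspace.span B"
    using fspace.basis_exists by metis
  have sp: "fspace.span B = fspace.span (z ` S)"
    using B(1,3) by (metis fspace.span_mono fspace.span_span subset_antisym)
  \<comment> \<open>One preimage is chosen for each vector of a basis, so that \<open>X\<close> has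
    as many elements as the basis.\<close>
  obtain X where X: "X \<subseteq> S" "inj_on z X" "B = z ` X"
    using subset_image_inj B(1) by metis
  have "X \<in> {X \<in> vector_independent_sets E z. X \<subseteq> S}"
    using X B(2) assms(2) by (auto simp: vector_independent_sets_def)
  moreover have "card X = fspace.dim (fspace.span (z ` S))"
    using fspace.dim_span_eq_card_independent[OF B(2)] sp X(2,3) by (metis card_image)
  ultimately show "fspace.dim (fspace.span (z ` S)) \<in> card ` {X \<in> vector_independent_sets E z. X \<subseteq> S}"
    by (metis imageI)
  fix n assume "n \<in> card ` {X \<in> vector_independent_sets E z. X \<subseteq> S}"
  then obtain Y where Y: "n = card Y" "inj_on z Y" "fspace.independent (z ` Y)" "Y \<subseteq> S"
    by (auto simp: vector_independent_sets_def)
  have "finite B" using B(1) assms finite_subset by (metis finite_imageI)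
  moreover have "z ` Y \<subseteq> fspace.span B" using Y(4) B(3) by blast
  ultimately have "card (z ` Y) \<le> card B"
    using fspace.independent_span_bound Y(3) by blast
  then show "n \<le> fspace.dim (fspace.span (z ` S))"
    using fspace.dim_span_eq_card_independent[OF B(2)] sp Y(1,2) by (metis card_image)
qed

theorem theorem4p2:
  fixes G :: "('v, 'e, 'k :: field) gain_sgraph"
  assumes "CHAR('k) \<noteq> 2"
    and "gain_signed_graph G"
  shows "is_matroid_rank_function (extended_edges G) (graph_rank G) \<and>
    (\<forall>S \<subseteq> extended_edges G.
       graph_rank G S = int (fspace.dim (fspace.span (zvec G ` S))))"
proof -
  interpret gain_signed_graph G by (rule assms(2))
  have rank: "graph_rank G S = int (fspace.dim (fspace.span (zvec G ` S)))"
    if "S \<subseteq> extended_edges G" for S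
    using graph_rank_eq_dim[OF that two_nonzero[OF assms(1)]] .
  have fin: "finite (extended_edges G)" using finite_edges by (simp add: extended_edges_def)
  have "is_matroid_rank_function (extended_edges G) (graph_rank G)"
    unfolding is_matroid_rank_function_def
    using vector_matroid[OF fin] vector_matroid_rank[OF fin] rank by metis
  with rank show ?thesis by blast
qed

end
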